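(* Let $d\ge 1$ and let $\mathbf X=(X_t)_{t\ge 0}$ be an isotropic unimodal Lévy process in $\mathbb R^d$ with Lévy–Khintchine exponent $\psi$ and transition density $p(t,\cdot)$ on $\mathbb R^d\setminus\{0\}$. If $\psi\in\mathcal R^0_\alpha$ for some $\alpha\in(0,2)$, then $$\lim_{\substack{|x|\to+\infty\\ t\psi(|x|^{-1})\to 0}}\frac{p(t,x)}{|x|^{-d}\,t\,\psi(|x|^{-1})}=\mathcal A_{d,\alpha},$$ where $$\mathcal A_{d,\alpha}=\alpha\,2^{\alpha-1}\pi^{-d/2-1}\sin\Big(\frac{\alpha\pi}{2}\Big)\Gamma\Big(\frac{\alpha}{2}\Big)\Gamma\Big(\frac{d+\alpha}{2}\Big).$$
   Context: An isotropic Lévy process in $\mathbb R^d$ is a Lévy process $\mathbf X=(X_t)_{t\ge0}$ with $X_0=0$ a.s. such that each $X_t$ has a rotationally invariant distribution $p(t,dx)$. Its Lévy–Khintchine exponent $\psi$ is defined by $\int_{\mathbb R^d}e^{i\langle\xi,x\rangle}p(t,dx)=e^{-t\psi(\xi)}$, with $\psi(\xi)=\int_{\mathbb R^d}(1-\cos\langle\xi,x\rangle)\,\nu(dx)+\eta|\xi|^2$, where $\eta\ge0$ and $\nu$ is a rotationally invariant Lévy measure. The function $\psi$ is radial and one writes $\psi(r)=\psi(\xi)$ for $r=|\xi|$. A Borel measure is isotropic unimodal if it is absolutely continuous on $\mathbb R^d\setminus\{0\}$ with a radial, radially non-increasing density. $\mathbf X$ is isotropic unimodal if $p(t,dx)$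 is isotropic unimodal for every $t>0$; then $p(t,x)$ denotes this radial, radially non-increasing density on $\mathbb R^d\setminus\{0\}$ (an atom at $0$ is allowed). Regular variation: $f:[x_0,+\infty)\to(0,+\infty)$, $x_0>0$, is in $\mathcal R^\infty_\alpha$ (regularly varying of index $\alpha$ at infinity) if $f(\lambda x)/f(x)\to\lambda^\alpha$ as $x\to+\infty$ for each $\lambda>0$. A function $f$, positive near zero, is in $\mathcal R^0_\alpha$ (regularly varying of index $\alpha$ at zero) if $x\mapsto f(x^{-1})^{-1}$ is in $\mathcal R^\infty_\alpha$, i.e. $f(\lambda x)/f(x)\to\lambda^\alpha$ as $x\to0^+$ for each $\lambda>0$. The condition $\psi\in\mathcal R^0_\alpha$ refers to $r\mapsto\psi(r)$. The joint limit means: for every $\varepsilon>0$ there is $\delta>0$ such that the quotient is within $\varepsilon$ of the limit for all $t>0$ and all $x$ with $|x|\ge\delta^{-1}$ and $t\psi(|x|^{-1})\le\delta$. *)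

theory Defs
  imports "HOL-Probability.Probability"
begin

(* Stochastic continuity is assumed in place of cadlag paths. It is the weaker condition:
   stationary increments and cadlag paths imply it. *)
locale levy_process = prob_space M for M :: "'w measure" +
  fixes X :: "real \<Rightarrow> 'w \<Rightarrow> 'a::euclidean_space"
  assumes random_variable: "\<And>t. 0 \<le> t \<Longrightarrow> X t \<in> borel_measurable M"
    and start: "AE \<omega> in M. X 0 \<omega> = 0"
    and indep_increments:
      "\<And>(n::nat) \<tau>. 0 \<le> \<tau> 0 \<Longrightarrow> (\<And>i. i < n \<Longrightarrow> \<tau> i \<le> \<tau> (Suc i)) \<Longrightarrow>
         indep_vars (\<lambda>_. borel) (\<lambda>i \<omega>. X (\<tau> (Suc i)) \<omega> - X (\<tau> i) \<omega>) {..<n}"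
    and stationary_increments:
      "\<And>s h. 0 \<le> s \<Longrightarrow> 0 \<le> h \<Longrightarrow>
         distr M borel (\<lambda>\<omega>. X (s + h) \<omega> - X s \<omega>) = distr M borel (X h)"
    and stochastic_continuity:
      "\<And>s \<epsilon>. 0 \<le> s \<Longrightarrow> 0 < \<epsilon> \<Longrightarrow>
         ((\<lambda>t. prob {\<omega> \<in> space M. \<epsilon> < dist (X t \<omega>) (X s \<omega>)}) \<longlongrightarrow> 0) (at s within {0..})"

(* Invariance under the full orthogonal group, so that for d = 1 this means symmetry. *)
definition rotation_invariant :: "'a::euclidean_space measure \<Rightarrow> bool" where
  "rotation_invariant \<mu> \<longleftrightarrow>
     (\<forall>T :: 'a \<Rightarrow> 'a. orthogonal_transformation T \<longrightarrow> distr \<mu> borel T = \<mu>)"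

definition isotropic_levy_process ::
    "'w measure \<Rightarrow> (real \<Rightarrow> 'w \<Rightarrow> 'a::euclidean_space) \<Rightarrow> bool" where
  "isotropic_levy_process M X \<longleftrightarrow>
     levy_process M X \<and> (\<forall>t\<ge>0. rotation_invariant (distr M borel (X t)))"

definition levy_measure :: "'a::euclidean_space measure \<Rightarrow> bool" where
  "levy_measure \<nu> \<longleftrightarrow>
     sets \<nu> = sets borel \<and> emeasure \<nu> {0} = 0 \<and>
     (\<integral>\<^sup>+x. ennreal (min 1 ((norm x)\<^sup>2)) \<partial>\<nu>) < \<infinity>"

definition levy_khintchine_exponent ::
    "'w measure \<Rightarrow> (real \<Rightarrow> 'w \<Rightarrow> 'a::euclidean_space) \<Rightarrow> ('a \<Rightarrow> real) \<Rightarrow> bool" where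
  "levy_khintchine_exponent M X \<psi> \<longleftrightarrow>
     (\<forall>t\<ge>0. \<forall>\<xi>. (CLINT x|distr M borel (X t). iexp (\<xi> \<bullet> x)) = complex_of_real (exp (- t * \<psi> \<xi>))) \<and>
     (\<exists>\<eta> \<nu>. 0 \<le> \<eta> \<and> levy_measure \<nu> \<and> rotation_invariant \<nu> \<and>
        (\<forall>\<xi>. \<psi> \<xi> = (LINT x|\<nu>. 1 - cos (\<xi> \<bullet> x)) + \<eta> * (norm \<xi>)\<^sup>2))"

(* The value f 0 is irrelevant, and the measure may have an atom at 0. *)
definition unimodal_density :: "'a::euclidean_space measure \<Rightarrow> ('a \<Rightarrow> real) \<Rightarrow> bool" where
  "unimodal_density \<mu> f \<longleftrightarrow>
     f \<in> borel_measurable borel \<and>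
     (\<forall>x. x \<noteq> 0 \<longrightarrow> 0 \<le> f x) \<and>
     (\<forall>x y. x \<noteq> 0 \<longrightarrow> norm x = norm y \<longrightarrow> f x = f y) \<and>
     (\<forall>x y. x \<noteq> 0 \<longrightarrow> norm x \<le> norm y \<longrightarrow> f y \<le> f x) \<and>
     (\<forall>A\<in>sets borel. 0 \<notin> A \<longrightarrow> emeasure \<mu> A = (\<integral>\<^sup>+x\<in>A. ennreal (f x) \<partial>lborel))"

definition isotropic_unimodal :: "'a::euclidean_space measure \<Rightarrow> bool" where
  "isotropic_unimodal \<mu> \<longleftrightarrow> sets \<mu> = sets borel \<and> (\<exists>f. unimodal_density \<mu> f)"

definition isotropic_unimodal_levy_process ::
    "'w measure \<Rightarrow> (real \<Rightarrow> 'w \<Rightarrow> 'a::euclidean_space) \<Rightarrow> bool" where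
  "isotropic_unimodal_levy_process M X \<longleftrightarrow>
     isotropic_levy_process M X \<and> (\<forall>t>0. isotropic_unimodal (distr M borel (X t)))"

(* The density is determined only up to its values on countably many spheres for each t;
   p may be any version that is radial and radially non-increasing. *)
definition transition_density ::
    "'w measure \<Rightarrow> (real \<Rightarrow> 'w \<Rightarrow> 'a::euclidean_space) \<Rightarrow> (real \<Rightarrow> 'a \<Rightarrow> real) \<Rightarrow> bool" where
  "transition_density M X p \<longleftrightarrow> (\<forall>t>0. unimodal_density (distr M borel (X t)) (p t))"

definition regularly_varying_at_top :: "real \<Rightarrow> (real \<Rightarrow> real) \<Rightarrow> bool" where
  "regularly_varying_at_top \<alpha> f \<longleftrightarrow>
     (\<exists>x0>0. \<forall>x\<ge>x0. 0 < f x) \<and>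
     (\<forall>c>0. ((\<lambda>x. f (c * x) / f x) \<longlongrightarrow> c powr \<alpha>) at_top)"

definition regularly_varying_at_zero :: "real \<Rightarrow> (real \<Rightarrow> real) \<Rightarrow> bool" where
  "regularly_varying_at_zero \<alpha> f \<longleftrightarrow>
     regularly_varying_at_top \<alpha> (\<lambda>x. inverse (f (inverse x)))"

definition density_const :: "nat \<Rightarrow> real \<Rightarrow> real" where
  "density_const d \<alpha> =
     \<alpha> * 2 powr (\<alpha> - 1) * pi powr (- real d / 2 - 1) * sin (\<alpha> * pi / 2)
       * Gamma (\<alpha> / 2) * Gamma ((real d + \<alpha>) / 2)"

end

theory Submission
  imports Defs
begin

text \<open>
  Suppose the limit fails along some sequence of times t n and points x n. Put r n = |x n| and let \<mu> n be the
  law of the process at time t n, divided by r n, and a n = t n * \<psi> (1 / r n), so that a n tends to 0. Regular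
  variation of \<psi> says that (1 - \<phi>) / a n, where \<phi> is the characteristic function of \<mu> n at \<xi>, tends to
  |\<xi>| powr \<alpha> for every \<xi>. This is the exponent of the isotropic stable process, whose jump measure has
  density c * |y| powr (- d - \<alpha>) with c = \<open>density_const\<close>. Hence the measures \<mu> n / a n should converge
  to this jump measure away from the origin, and their densities, being radially decreasing, should converge
  pointwise. At the unit vector x n / r n the density of \<mu> n / a n is exactly the quotient of the theorem, which
  gives the contradiction.

  The convergence of measures is reduced to one real variable. Averaging the exponents over Gaussian
  frequencies \<xi> of variance k replaces 1 - cos by 1 - v^k with v = exp (- |y|^2 / 2)
  (\<open>integral_one_minus_gaussian\<close>), so that for every k the integrals of 1 - v^k against \<mu> n / a n
  converge (\<open>tendsto_integral_one_minus_gaussian\<close>). The limits are those of the stable jump measure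
  (\<open>has_bochner_integral_stable\<close>); this step determines the constant, through polar coordinates, Gamma
  integrals and the reflection formula. By the Weierstrass approximation theorem the convergence extends from
  polynomials in v to continuous functions of v (\<open>tendsto_integral_if_moments\<close>), in particular to bumps
  supported in thin annuli, and monotonicity of the densities does the rest
  (\<open>unimodal_limit_annulus\<close>, \<open>unimodal_density_tendsto\<close>).

  The averaging requires an integrable bound on the exponents. It comes from a bound on truncated second moments
  of \<mu> n / a n (\<open>eventually_truncated_moment_le\<close>): by an Egorov argument the exponents are bounded
  uniformly on a large set of frequencies in [0,1], and the average of 1 - cos over such a set dominates the
  truncated square.
\<close>

section \<open>Radial integrals\<close>

text \<open>
  The constant in polar coordinates when the radial variable is half the squared norm; in terms of the
  surface area of the unit sphere it is that area times 2 powr (d / 2 - 1).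
\<close>
definition radial_const :: "nat \<Rightarrow> real" where
  "radial_const d = unit_ball_vol (real d) * 2 powr (real d / 2) * (real d / 2)"

lemma radial_const_pos: "0 < d \<Longrightarrow> 0 < radial_const d"
  by (simp add: radial_const_def)

lemma nn_integral_powr_from_0:
  fixes p u :: real
  assumes "0 < p" "0 \<le> u"
  shows "(\<integral>\<^sup>+x. ennreal (indicator {0<..u} x * x powr (p - 1)) \<partial>lborel) = ennreal (u powr p / p)"
proof -
  have "((\<lambda>x. x powr (p - 1)) has_integral (u powr p / p)) {0..u}"
    using has_integral_powr_from_0[of "p - 1" u] assms by simp
  then have *: "((\<lambda>x. x powr (p - 1)) has_integral (u powr p / p)) {0<..u}"
    by (subst (asm) has_integral_spike_set_eq[where T="{0<..u}"]) (auto intro: negligible_subset[of "{0}"])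
  have "(\<integral>\<^sup>+x. ennreal (indicator {0<..u} x * x powr (p - 1)) \<partial>lborel) = ennreal (u powr p / p)"
    by (rule nn_integral_has_integral_lebesgue[OF _ *]) auto
  then show ?thesis .
qed

text \<open>
  Polar coordinates for radial integrands. With half the squared norm as the radial variable, a Gaussian
  becomes an exponential, so that all later radial integrals are Gamma integrals without any substitution.
  Both sides are determined by the half-lines up to u, where the left side is the volume of the ball of
  radius sqrt (2 * u).
\<close>
lemma distr_half_norm_square:
  "distr lborel borel (\<lambda>x :: 'a::euclidean_space. (norm x)\<^sup>2 / 2) =
     density lborel (\<lambda>u. ennreal (radial_const DIM('a) * (indicator {0<..} u * u powr (real DIM('a) / 2 - 1))))"
    (is "?L = ?R")
proof (rule measure_eqI_generator_eq)
  let ?E = "range (\<lambda>u::real. {..u})" and ?d = "real DIM('a)" and ?f = "\<lambda>x :: 'a. (norm x)\<^sup>2 / 2"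
  show "Int_stable ?E"
    by (auto simp: Int_stable_def)
  show "?E \<subseteq> Pow UNIV" by auto
  have "sets (borel :: real measure) = sigma_sets UNIV ?E"
    by (subst borel_eq_atMost) (simp add: sets_measure_of)
  then show "sets ?L = sigma_sets UNIV ?E" "sets ?R = sigma_sets UNIV ?E"
    by simp_all
  have eqL: "emeasure ?L {..u} = (if 0 \<le> u then ennreal (unit_ball_vol ?d * (2 * u) powr (?d / 2)) else 0)" for u
  proof -
    have "?f -` {..u} = (if 0 \<le> u then cball 0 (sqrt (2 * u)) else {})"
    proof (cases "0 \<le> u")
      case True
      have "(norm x)\<^sup>2 / 2 \<le> u \<longleftrightarrow> norm x \<le> sqrt (2 * u)" for x :: 'a
        using real_sqrt_le_iff[of "(norm x)\<^sup>2" "2 * u"] by (auto simp: field_simps)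
      then show ?thesis using True by auto
    next
      case False
      have "\<not> (norm x)\<^sup>2 / 2 \<le> u" for x :: 'a
        using False zero_le_power2[of "norm x"] by linarith
      then show ?thesis using False by auto
    qed
    moreover have "sqrt (2 * u) ^ DIM('a) = (2 * u) powr (?d / 2)" if "0 \<le> u"
    proof (cases "u = 0")
      case False
      then have "sqrt (2 * u) ^ DIM('a) = sqrt (2 * u) powr ?d"
        using that by (subst powr_realpow) auto
      also have "\<dots> = (2 * u) powr (?d / 2)"
        using that False by (simp add: powr_half_sqrt[symmetric] powr_powr)
      finally show ?thesis .
    qed simp
    ultimately show ?thesis
      by (simp add: emeasure_distr emeasure_cball)
  qed
  have eqR: "emeasure ?R {..u} = (if 0 \<le> u then ennreal (unit_ball_vol ?d * (2 * u) powr (?d / 2)) else 0)" for u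
  proof -
    have "emeasure ?R {..u} = (\<integral>\<^sup>+x. ennreal (radial_const DIM('a)) * ennreal (indicator {0<..u} x * x powr (?d / 2 - 1)) \<partial>lborel)"
      by (subst emeasure_density)
        (auto intro!: nn_integral_cong simp: ennreal_mult[symmetric] radial_const_pos less_imp_le split: split_indicator)
    also have "\<dots> = ennreal (radial_const DIM('a)) * (\<integral>\<^sup>+x. ennreal (indicator {0<..u} x * x powr (?d / 2 - 1)) \<partial>lborel)"
      by (rule nn_integral_cmult) measurable
    also have "\<dots> = (if 0 \<le> u then ennreal (unit_ball_vol ?d * (2 * u) powr (?d / 2)) else 0)"
    proof (cases "0 \<le> u")
      case True
      have "radial_const DIM('a) * (u powr (?d / 2) / (?d / 2)) = unit_ball_vol ?d * (2 * u) powr (?d / 2)"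
        using True by (simp add: radial_const_def powr_mult)
      moreover have "(\<integral>\<^sup>+x. ennreal (indicator {0<..u} x * x powr (?d / 2 - 1)) \<partial>lborel) = ennreal (u powr (?d / 2) / (?d / 2))"
        by (rule nn_integral_powr_from_0) (use True in auto)
      ultimately show ?thesis
        using True radial_const_pos[of "DIM('a)"] by (simp add: ennreal_mult'[symmetric] less_imp_le)
    next
      case False
      then have "{0<..u} = {}" by auto
      then show ?thesis using False by simp
    qed
    finally show ?thesis .
  qed
  show "emeasure ?L X = emeasure ?R X" if "X \<in> ?E" for X
    using that eqL eqR by auto
  show "range (\<lambda>n::nat. {..real n}) \<subseteq> ?E" by auto
  show "(\<Union>n::nat. {..real n}) = UNIV"
    using real_arch_simple by auto
  show "emeasure ?L {..real n} \<noteq> \<infinity>" for n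
    by (simp add: eqL)
qed

lemma nn_integral_radial:
  assumes [measurable]: "F \<in> borel_measurable borel"
  shows "(\<integral>\<^sup>+x. F ((norm (x :: 'a::euclidean_space))\<^sup>2 / 2) \<partial>lborel) =
    ennreal (radial_const DIM('a)) * (\<integral>\<^sup>+u. ennreal (indicator {0<..} u * u powr (real DIM('a) / 2 - 1)) * F u \<partial>lborel)"
proof -
  have "(\<integral>\<^sup>+x. F ((norm (x :: 'a))\<^sup>2 / 2) \<partial>lborel) = (\<integral>\<^sup>+u. F u \<partial>distr lborel borel (\<lambda>x :: 'a. (norm x)\<^sup>2 / 2))"
    by (simp add: nn_integral_distr)
  also have "\<dots> = (\<integral>\<^sup>+u. ennreal (radial_const DIM('a)) * (ennreal (indicator {0<..} u * u powr (real DIM('a) / 2 - 1)) * F u) \<partial>lborel)"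
    unfolding distr_half_norm_square
    by (subst nn_integral_density)
      (auto intro!: nn_integral_cong simp: ennreal_mult mult.assoc radial_const_pos less_imp_le)
  also have "\<dots> = ennreal (radial_const DIM('a)) * (\<integral>\<^sup>+u. ennreal (indicator {0<..} u * u powr (real DIM('a) / 2 - 1)) * F u \<partial>lborel)"
    by (rule nn_integral_cmult) measurable
  finally show ?thesis .
qed

lemma norm_powr_half_square: "norm x powr a = (2 * ((norm x)\<^sup>2 / 2)) powr (a / 2)"
proof (cases "norm x = 0")
  case False
  then have "(norm x)\<^sup>2 = norm x powr 2" by simp
  then have "((norm x)\<^sup>2) powr (a / 2) = norm x powr a" by (simp only: powr_powr) simp
  then show ?thesis by simp
qed auto

lemma nn_integral_Gamma_scaled:
  fixes s q :: real
  assumes "0 < s" "0 < q"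
  shows "(\<integral>\<^sup>+u. ennreal (indicator {0<..} u * u powr (q - 1) * exp (- s * u)) \<partial>lborel) = ennreal (s powr (- q) * Gamma q)"
proof -
  let ?f = "\<lambda>t. ennreal (indicator {0..} t * t powr (q - 1) / exp t)"
  have "ennreal (Gamma q) = (\<integral>\<^sup>+t. ?f t \<partial>lborel)"
    by (rule Gamma_conv_nn_integral_real) fact
  also have "\<dots> = ennreal s * (\<integral>\<^sup>+u. ?f (0 + s * u) \<partial>lborel)"
    using assms by (subst nn_integral_real_affine[of _ s 0]) auto
  also have "\<dots> = ennreal s * (\<integral>\<^sup>+u. ennreal (s powr (q - 1)) * ennreal (indicator {0<..} u * u powr (q - 1) * exp (- s * u)) \<partial>lborel)"
    by (intro arg_cong2[where f="(*)"] refl nn_integral_cong)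
      (use assms in \<open>auto simp: ennreal_mult[symmetric] powr_mult exp_minus field_simps zero_le_mult_iff split: split_indicator\<close>)
  also have "\<dots> = ennreal s * (ennreal (s powr (q - 1)) * (\<integral>\<^sup>+u. ennreal (indicator {0<..} u * u powr (q - 1) * exp (- s * u)) \<partial>lborel))"
    by (subst nn_integral_cmult) auto
  finally have *: "ennreal (Gamma q) = ennreal (s powr q) * (\<integral>\<^sup>+u. ennreal (indicator {0<..} u * u powr (q - 1) * exp (- s * u)) \<partial>lborel)"
    using assms by (simp add: mult.assoc[symmetric] ennreal_mult[symmetric] powr_diff)
  have "ennreal (s powr (- q) * Gamma q) = ennreal (s powr (- q)) * ennreal (Gamma q)"
    by (rule ennreal_mult') simp
  also have "\<dots> = (ennreal (s powr (- q)) * ennreal (s powr q)) * (\<integral>\<^sup>+u. ennreal (indicator {0<..} u * u powr (q - 1) * exp (- s * u)) \<partial>lborel)"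
    by (simp only: * mult.assoc)
  also have "ennreal (s powr (- q)) * ennreal (s powr q) = 1"
    using assms by (simp add: ennreal_mult[symmetric] powr_minus)
  finally show ?thesis by simp
qed

lemma nn_integral_norm_powr_gaussian:
  fixes a :: real
  assumes "- real DIM('a) < a"
  shows "(\<integral>\<^sup>+x. ennreal (norm (x :: 'a::euclidean_space) powr a * exp (- (norm x)\<^sup>2 / 2)) \<partial>lborel) =
    ennreal (radial_const DIM('a) * (2 powr (a / 2) * Gamma ((real DIM('a) + a) / 2)))"
proof -
  let ?d = "real DIM('a)" and ?F = "\<lambda>u. ennreal ((2 * u) powr (a / 2) * exp (- u))"
  have "(\<integral>\<^sup>+x. ennreal (norm (x :: 'a) powr a * exp (- (norm x)\<^sup>2 / 2)) \<partial>lborel) = (\<integral>\<^sup>+x. ?F ((norm (x :: 'a))\<^sup>2 / 2) \<partial>lborel)"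
    by (simp only: norm_powr_half_square[of _ a]) simp
  also have "\<dots> = ennreal (radial_const DIM('a)) * (\<integral>\<^sup>+u. ennreal (indicator {0<..} u * u powr (?d / 2 - 1)) * ?F u \<partial>lborel)"
    by (rule nn_integral_radial) measurable
  also have "(\<integral>\<^sup>+u. ennreal (indicator {0<..} u * u powr (?d / 2 - 1)) * ?F u \<partial>lborel) =
     (\<integral>\<^sup>+u. ennreal (2 powr (a / 2)) * ennreal (indicator {0<..} u * u powr ((?d + a) / 2 - 1) * exp (- 1 * u)) \<partial>lborel)"
    by (intro nn_integral_cong)
      (auto simp: ennreal_mult[symmetric] powr_mult powr_diff powr_add add_divide_distrib split: split_indicator)
  also have "\<dots> = ennreal (2 powr (a / 2)) * ennreal (Gamma ((?d + a) / 2))"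
    using assms by (subst nn_integral_cmult, simp, subst nn_integral_Gamma_scaled) auto
  finally show ?thesis
    using radial_const_pos[of "DIM('a)"] by (simp add: ennreal_mult' less_imp_le)
qed

text \<open>
  Write 1 - exp (- s * u) as the integral of s * exp (- s * v) over 0 < v < u and exchange the order of
  integration: the inner integral over u > v is a power of v, and a Gamma integral remains.
\<close>
lemma nn_integral_stable_radial:
  fixes \<alpha> s :: real
  assumes "0 < \<alpha>" "\<alpha> < 2" "0 < s"
  shows "(\<integral>\<^sup>+u. ennreal (indicator {0<..} u * (1 - exp (- s * u)) * u powr (- \<alpha> / 2 - 1)) \<partial>lborel) =
    ennreal (2 / \<alpha> * s powr (\<alpha> / 2) * Gamma (1 - \<alpha> / 2))"
proof -
  \<comment> \<open>The indicator of 0 < v < u, written so that it factorises for each fixed v.\<close>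
  let ?I = "\<lambda>v u. indicator {0<..} v * indicator {v<..} u :: real"
  have inner: "(\<integral>\<^sup>+v. ennreal (indicator {0<..<u} v * (s * exp (- s * v))) \<partial>lborel) = ennreal (1 - exp (- s * u))"
    if "0 < u" for u
  proof -
    have "((\<lambda>v. s * exp (- s * v)) has_integral (- exp (- s * u) - - exp (- s * 0))) {0..u}"
      by (rule fundamental_theorem_of_calculus)
        (use that in \<open>auto intro!: derivative_eq_intros simp: has_real_derivative_iff_has_vector_derivative[symmetric]\<close>)
    then have *: "((\<lambda>v. s * exp (- s * v)) has_integral (1 - exp (- s * u))) {0<..<u}"
      by (subst (asm) has_integral_spike_set_eq[where T="{0<..<u}"])
        (auto intro: negligible_subset[of "{0,u}"])
    show ?thesis
      by (rule nn_integral_has_integral_lebesgue[OF _ *]) (use assms in auto)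
  qed
  have outer: "(\<integral>\<^sup>+u. ennreal (indicator {v<..} u * u powr (- \<alpha> / 2 - 1)) \<partial>lborel) = ennreal (2 / \<alpha> * v powr (- \<alpha> / 2))"
    if "0 < v" for v
  proof -
    have "((\<lambda>u. u powr (- \<alpha> / 2 - 1)) has_integral - (v powr (- \<alpha> / 2 - 1 + 1)) / (- \<alpha> / 2 - 1 + 1)) {v..}"
      by (rule has_integral_powr_to_inf) (use that assms in auto)
    then have *: "((\<lambda>u. u powr (- \<alpha> / 2 - 1)) has_integral (2 / \<alpha> * v powr (- \<alpha> / 2))) {v<..}"
      by (subst (asm) has_integral_spike_set_eq[where T="{v<..}"])
        (auto intro: negligible_subset[of "{v}"] simp: mult_ac)
    show ?thesis
      by (rule nn_integral_has_integral_lebesgue[OF _ *]) auto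
  qed
  have "(\<integral>\<^sup>+u. ennreal (indicator {0<..} u * (1 - exp (- s * u)) * u powr (- \<alpha> / 2 - 1)) \<partial>lborel) =
    (\<integral>\<^sup>+u. (\<integral>\<^sup>+v. ennreal (?I v u * (s * exp (- s * v)) * u powr (- \<alpha> / 2 - 1)) \<partial>lborel) \<partial>lborel)"
  proof (rule nn_integral_cong)
    fix u :: real
    show "ennreal (indicator {0<..} u * (1 - exp (- s * u)) * u powr (- \<alpha> / 2 - 1)) =
      (\<integral>\<^sup>+v. ennreal (?I v u * (s * exp (- s * v)) * u powr (- \<alpha> / 2 - 1)) \<partial>lborel)"
    proof (cases "0 < u")
      case True
      have "(\<integral>\<^sup>+v. ennreal (?I v u * (s * exp (- s * v)) * u powr (- \<alpha> / 2 - 1)) \<partial>lborel) =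
        (\<integral>\<^sup>+v. ennreal (indicator {0<..<u} v * (s * exp (- s * v))) * ennreal (u powr (- \<alpha> / 2 - 1)) \<partial>lborel)"
        using assms by (intro nn_integral_cong) (auto simp: ennreal_mult[symmetric] split: split_indicator)
      also have "\<dots> = ennreal (1 - exp (- s * u)) * ennreal (u powr (- \<alpha> / 2 - 1))"
        by (subst nn_integral_multc, simp, subst inner[OF True]) simp
      finally show ?thesis
        using True assms by (simp add: ennreal_mult[symmetric])
    next
      case False
      then have I: "?I v u = 0" for v by (auto split: split_indicator)
      show ?thesis unfolding I using False by simp
    qed
  qed
  also have "\<dots> = (\<integral>\<^sup>+v. (\<integral>\<^sup>+u. ennreal (?I v u * (s * exp (- s * v)) * u powr (- \<alpha> / 2 - 1)) \<partial>lborel) \<partial>lborel)"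
  proof (rule lborel_pair.Fubini')
    have eq: "(\<lambda>(v, u). indicator {v<..} u :: real) = indicator {p. fst p < (snd p :: real)}"
      by (auto simp: fun_eq_iff split: split_indicator)
    have "{p \<in> space (lborel \<Otimes>\<^sub>M lborel). fst p < (snd p :: real)} \<in> sets (lborel \<Otimes>\<^sub>M lborel)"
      by measurable
    then have "{p :: real \<times> real. fst p < snd p} \<in> sets (lborel \<Otimes>\<^sub>M lborel)"
      by (simp add: space_pair_measure)
    then have [measurable]: "(\<lambda>(v :: real, u). indicator {v<..} u :: real) \<in> borel_measurable (lborel \<Otimes>\<^sub>M lborel)"
      unfolding eq by (rule borel_measurable_indicator)
    show "(\<lambda>(v, u). ennreal (?I v u * (s * exp (- s * v)) * u powr (- \<alpha> / 2 - 1))) \<in> borel_measurable (lborel \<Otimes>\<^sub>M lborel)"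
      by measurable
  qed
  also have "\<dots> = (\<integral>\<^sup>+v. ennreal (2 / \<alpha> * s) * ennreal (indicator {0<..} v * v powr ((1 - \<alpha> / 2) - 1) * exp (- s * v)) \<partial>lborel)"
  proof (rule nn_integral_cong)
    fix v :: real
    show "(\<integral>\<^sup>+u. ennreal (?I v u * (s * exp (- s * v)) * u powr (- \<alpha> / 2 - 1)) \<partial>lborel) =
      ennreal (2 / \<alpha> * s) * ennreal (indicator {0<..} v * v powr ((1 - \<alpha> / 2) - 1) * exp (- s * v))"
    proof (cases "0 < v")
      case True
      have "(\<integral>\<^sup>+u. ennreal (?I v u * (s * exp (- s * v)) * u powr (- \<alpha> / 2 - 1)) \<partial>lborel) =
        (\<integral>\<^sup>+u. ennreal (s * exp (- s * v)) * ennreal (indicator {v<..} u * u powr (- \<alpha> / 2 - 1)) \<partial>lborel)"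
        using assms True by (intro nn_integral_cong) (auto simp: ennreal_mult[symmetric] split: split_indicator)
      also have "\<dots> = ennreal (s * exp (- s * v)) * ennreal (2 / \<alpha> * v powr (- \<alpha> / 2))"
        by (subst nn_integral_cmult, simp, subst outer[OF True]) simp
      finally show ?thesis
        using True assms by (simp add: ennreal_mult[symmetric] mult_ac)
    qed simp
  qed
  also have "\<dots> = ennreal (2 / \<alpha> * s) * ennreal (s powr (- (1 - \<alpha> / 2)) * Gamma (1 - \<alpha> / 2))"
    using assms by (subst nn_integral_cmult, simp, subst nn_integral_Gamma_scaled) auto
  also have "\<dots> = ennreal (2 / \<alpha> * s powr (\<alpha> / 2) * Gamma (1 - \<alpha> / 2))"
    using assms by (simp add: ennreal_mult'[symmetric] powr_diff)
  finally show ?thesis .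
qed

text \<open>
  The Laplace exponent of the stable jump density: up to the constant, the weight s powr (\<alpha> / 2) that
  regular variation forces upon the limit in \<open>tendsto_integral_one_minus_gaussian\<close>.
\<close>
lemma nn_integral_stable:
  fixes \<alpha> s :: real
  assumes "0 < \<alpha>" "\<alpha> < 2" "0 < s"
  shows "(\<integral>\<^sup>+x. ennreal ((1 - exp (- s * ((norm x)\<^sup>2 / 2))) * norm (x :: 'a::euclidean_space) powr (- real DIM('a) - \<alpha>)) \<partial>lborel) =
    ennreal (radial_const DIM('a) * (2 powr (- (real DIM('a) + \<alpha>) / 2) * (2 / \<alpha> * s powr (\<alpha> / 2) * Gamma (1 - \<alpha> / 2))))"
proof -
  let ?d = "real DIM('a)"
  let ?F = "\<lambda>u. ennreal ((1 - exp (- s * u)) * (2 * u) powr ((- ?d - \<alpha>) / 2))"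
  have "(\<integral>\<^sup>+x. ennreal ((1 - exp (- s * ((norm x)\<^sup>2 / 2))) * norm (x :: 'a) powr (- ?d - \<alpha>)) \<partial>lborel) = (\<integral>\<^sup>+x. ?F ((norm (x :: 'a))\<^sup>2 / 2) \<partial>lborel)"
    by (simp only: norm_powr_half_square[of _ "- ?d - \<alpha>"])
  also have "\<dots> = ennreal (radial_const DIM('a)) * (\<integral>\<^sup>+u. ennreal (indicator {0<..} u * u powr (?d / 2 - 1)) * ?F u \<partial>lborel)"
    by (rule nn_integral_radial) measurable
  also have "(\<integral>\<^sup>+u. ennreal (indicator {0<..} u * u powr (?d / 2 - 1)) * ?F u \<partial>lborel) =
     (\<integral>\<^sup>+u. ennreal (2 powr (- (?d + \<alpha>) / 2)) * ennreal (indicator {0<..} u * (1 - exp (- s * u)) * u powr (- \<alpha> / 2 - 1)) \<partial>lborel)"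
  proof (rule nn_integral_cong)
    fix u :: real
    have e: "(- ?d - \<alpha>) / 2 = - (?d + \<alpha>) / 2" by simp
    have "u powr (?d / 2 - 1) * (2 * u) powr (- (?d + \<alpha>) / 2) = 2 powr (- (?d + \<alpha>) / 2) * u powr (- \<alpha> / 2 - 1)" if "0 < u"
    proof -
      have "(2 * u) powr (- (?d + \<alpha>) / 2) = 2 powr (- (?d + \<alpha>) / 2) * u powr (- (?d + \<alpha>) / 2)"
        using that by (simp add: powr_mult)
      moreover have "u powr (?d / 2 - 1) * u powr (- (?d + \<alpha>) / 2) = u powr (- \<alpha> / 2 - 1)"
        unfolding powr_add[symmetric] by (rule arg_cong[where f="(powr) u"]) (simp add: field_simps)
      ultimately show ?thesis by (simp add: mult.left_commute)
    qed
    then show "ennreal (indicator {0<..} u * u powr (?d / 2 - 1)) * ?F u =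
        ennreal (2 powr (- (?d + \<alpha>) / 2)) * ennreal (indicator {0<..} u * (1 - exp (- s * u)) * u powr (- \<alpha> / 2 - 1))"
      using assms unfolding e by (auto simp: ennreal_mult[symmetric] mult_ac split: split_indicator)
  qed
  also have "\<dots> = ennreal (2 powr (- (?d + \<alpha>) / 2)) * ennreal (2 / \<alpha> * s powr (\<alpha> / 2) * Gamma (1 - \<alpha> / 2))"
    using assms by (subst nn_integral_cmult, simp, subst nn_integral_stable_radial) auto
  finally have "(\<integral>\<^sup>+x. ennreal ((1 - exp (- s * ((norm x)\<^sup>2 / 2))) * norm (x :: 'a) powr (- ?d - \<alpha>)) \<partial>lborel) =
    ennreal (radial_const DIM('a)) * (ennreal (2 powr (- (?d + \<alpha>) / 2)) * ennreal (2 / \<alpha> * s powr (\<alpha> / 2) * Gamma (1 - \<alpha> / 2)))" .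
  then show ?thesis
    by (simp only: ennreal_mult'[OF less_imp_le[OF radial_const_pos[OF DIM_positive]]] ennreal_mult'[OF powr_ge_zero])
qed

section \<open>Gaussian averages of characteristic functions\<close>

definition gaussian :: "'a::euclidean_space measure" where
  "gaussian = density lborel (\<lambda>x. ennreal (\<Prod>b\<in>Basis. std_normal_density (x \<bullet> b)))"

lemma sets_gaussian[simp, measurable_cong]: "sets (gaussian :: 'a::euclidean_space measure) = sets borel"
  by (simp add: gaussian_def)

lemma space_gaussian[simp]: "space (gaussian :: 'a::euclidean_space measure) = UNIV"
  by (simp add: gaussian_def)

lemma norm_square_eq_sum: "(norm (x :: 'a::euclidean_space))\<^sup>2 = (\<Sum>b\<in>Basis. (x \<bullet> b)\<^sup>2)"
  unfolding power2_norm_eq_inner by (subst euclidean_inner) (simp add: power2_eq_square)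

lemma prod_std_normal_density:
  "(\<Prod>b\<in>Basis. std_normal_density ((x :: 'a::euclidean_space) \<bullet> b)) =
     (2 * pi) powr (- real DIM('a) / 2) * exp (- (norm x)\<^sup>2 / 2)"
proof -
  have "(\<Prod>b\<in>Basis. std_normal_density (x \<bullet> b)) = (1 / sqrt (2 * pi)) ^ DIM('a) * exp (\<Sum>b\<in>Basis. - (x \<bullet> b)\<^sup>2 / 2)"
    by (simp only: std_normal_density_def prod.distrib prod_constant exp_sum[OF finite_Basis])
  also have "(\<Sum>b\<in>Basis. - (x \<bullet> b)\<^sup>2 / 2) = - (norm x)\<^sup>2 / 2"
    by (simp add: norm_square_eq_sum sum_negf sum_divide_distrib)
  also have "(1 / sqrt (2 * pi)) ^ DIM('a) = (2 * pi) powr (- real DIM('a) / 2)"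
  proof -
    have "(1 / sqrt (2 * pi)) ^ DIM('a) = ((2 * pi) powr (- 1 / 2)) powr real DIM('a)"
      by (subst powr_realpow) (auto simp: powr_minus_divide powr_half_sqrt)
    then show ?thesis by (simp only: powr_powr) simp
  qed
  finally show ?thesis .
qed

lemma prob_space_gaussian: "prob_space (gaussian :: 'a::euclidean_space measure)"
proof (rule prob_spaceI)
  interpret N: prob_space std_normal_distribution
    by (rule real_dist_normal_dist[THEN real_distribution.axioms(1)])
  have one: "(\<integral>\<^sup>+t. ennreal (std_normal_density t) \<partial>lborel) = 1"
    using N.emeasure_space_1 by (simp add: emeasure_density)
  have "emeasure (gaussian :: 'a measure) (space gaussian) = (\<integral>\<^sup>+x. (\<Prod>b\<in>Basis. ennreal (std_normal_density ((x :: 'a) \<bullet> b))) \<partial>lborel)"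
    by (simp add: gaussian_def emeasure_density prod_ennreal)
  also have "\<dots> = (\<Prod>b\<in>(Basis :: 'a set). (\<integral>\<^sup>+t. ennreal (std_normal_density t) \<partial>lborel))"
    by (subst nn_integral_lborel_prod[symmetric]) (auto simp: prod_ennreal)
  finally show "emeasure (gaussian :: 'a measure) (space gaussian) = 1"
    by (simp add: one)
qed

text \<open>
  The Bochner-integral companion of \<open>nn_integral_lborel_prod\<close>, for functions that are products over the
  coordinates. It reduces the Gaussian Fourier transform to dimension one.
\<close>
lemma integral_lborel_prod:
  fixes f :: "'a::euclidean_space \<Rightarrow> real \<Rightarrow> complex"
  assumes int: "\<And>b. b \<in> Basis \<Longrightarrow> integrable lborel (f b)"
  shows "(\<integral>x. (\<Prod>b\<in>Basis. f b (x \<bullet> b)) \<partial>lborel) = (\<Prod>b\<in>Basis. (\<integral>t. f b t \<partial>lborel))"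
proof -
  interpret product_sigma_finite "\<lambda>_ :: 'a. lborel :: real measure" ..
  have [measurable]: "f b \<in> borel_measurable borel" if "b \<in> Basis" for b
    using borel_measurable_integrable[OF int[OF that]] by simp
  have "(\<integral>x. (\<Prod>b\<in>Basis. f b (x \<bullet> b)) \<partial>lborel) =
    (\<integral>y. (\<Prod>b\<in>Basis. f b ((\<Sum>c\<in>Basis. y c *\<^sub>R c) \<bullet> b)) \<partial>(\<Pi>\<^sub>M b\<in>Basis. lborel))"
    by (subst lborel_eq, subst integral_distr) auto
  also have "\<dots> = (\<integral>y. (\<Prod>b\<in>Basis. f b (y b)) \<partial>(\<Pi>\<^sub>M b\<in>Basis. lborel))"
    by (intro Bochner_Integration.integral_cong prod.cong) (auto simp: inner_sum_left_Basis)
  also have "\<dots> = (\<Prod>b\<in>Basis. (\<integral>t. f b t \<partial>lborel))"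
    by (rule product_integral_prod) (auto simp: int)
  finally show ?thesis .
qed

lemma integral_cos_gaussian:
  "(\<integral>x. cos (y \<bullet> x) \<partial>gaussian) = exp (- (norm (y :: 'a::euclidean_space))\<^sup>2 / 2)"
proof -
  interpret prob_space "gaussian :: 'a measure" by (rule prob_space_gaussian)
  interpret N: prob_space std_normal_distribution
    by (rule real_dist_normal_dist[THEN real_distribution.axioms(1)])
  let ?f = "\<lambda>b t. std_normal_density t *\<^sub>R iexp ((y \<bullet> b) * t)"
  have int: "integrable lborel (?f b)" for b
  proof -
    have "integrable std_normal_distribution (\<lambda>t. iexp ((y \<bullet> b) * t))"
      by (rule N.integrable_const_bound[where B=1]) auto
    then show ?thesis by (subst (asm) integrable_density) auto
  qed
  have val: "(\<integral>t. ?f b t \<partial>lborel) = complex_of_real (exp (- (y \<bullet> b)\<^sup>2 / 2))" for b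
  proof -
    have "(\<integral>t. ?f b t \<partial>lborel) = char std_normal_distribution (y \<bullet> b)"
      unfolding char_def by (subst integral_density) auto
    then show ?thesis by (simp add: char_std_normal_distribution)
  qed
  have sum: "(\<Sum>b\<in>Basis. - (y \<bullet> b)\<^sup>2 / 2) = - (norm y)\<^sup>2 / 2"
    by (simp add: norm_square_eq_sum sum_negf sum_divide_distrib)
  have "(\<integral>x. iexp (y \<bullet> x) \<partial>gaussian) = (\<integral>x. (\<Prod>b\<in>Basis. ?f b (x \<bullet> b)) \<partial>lborel)"
    unfolding gaussian_def
  proof (subst integral_density)
    show "AE x in lborel. 0 \<le> (\<Prod>b\<in>Basis. std_normal_density ((x :: 'a) \<bullet> b))"
      by (intro AE_I2 prod_nonneg) auto
    have "iexp (y \<bullet> x) = (\<Prod>b\<in>Basis. iexp ((y \<bullet> b) * (x \<bullet> b)))" for x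
      by (subst euclidean_inner) (simp add: sum_distrib_left exp_sum)
    then show "(\<integral>x. (\<Prod>b\<in>Basis. std_normal_density (x \<bullet> b)) *\<^sub>R iexp (y \<bullet> x) \<partial>lborel) = (\<integral>x. (\<Prod>b\<in>Basis. ?f b (x \<bullet> b)) \<partial>lborel)"
      by (simp add: scaleR_conv_of_real prod.distrib)
  qed auto
  also have "\<dots> = (\<Prod>b\<in>Basis. \<integral>t. ?f b t \<partial>lborel)"
    by (rule integral_lborel_prod) (rule int)
  also have "\<dots> = complex_of_real (exp (\<Sum>b\<in>Basis. - (y \<bullet> b)\<^sup>2 / 2))"
    by (simp only: val) (simp add: exp_sum)
  finally have "(\<integral>x. iexp (y \<bullet> x) \<partial>gaussian) = complex_of_real (exp (- (norm y)\<^sup>2 / 2))"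
    by (simp only: sum)
  then have "Re (\<integral>x. iexp (y \<bullet> x) \<partial>gaussian) = exp (- (norm y)\<^sup>2 / 2)"
    by simp
  moreover have "Re (\<integral>x. iexp (y \<bullet> x) \<partial>gaussian) = (\<integral>x. cos (y \<bullet> x) \<partial>gaussian)"
    by (subst integral_Re[symmetric]) (auto intro!: integrable_const_bound[where B=1] simp: Re_exp)
  ultimately show ?thesis by simp
qed

text \<open>
  Absolute moments of the standard Gaussian. The value at the exponent \<alpha> enters the limit constant,
  and the second moment provides the dominating function for the averages over frequencies.
\<close>
lemma has_bochner_integral_norm_powr_gaussian:
  fixes a :: real
  assumes "- real DIM('a) < a"
  shows "has_bochner_integral gaussian (\<lambda>x. norm (x :: 'a::euclidean_space) powr a)
    ((2 * pi) powr (- real DIM('a) / 2) * (radial_const DIM('a) * (2 powr (a / 2) * Gamma ((real DIM('a) + a) / 2))))"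
proof (rule has_bochner_integral_nn_integral)
  let ?c = "(2 * pi) powr (- real DIM('a) / 2)"
  have "(\<integral>\<^sup>+x. ennreal (norm (x :: 'a) powr a) \<partial>gaussian) = (\<integral>\<^sup>+x. ennreal ?c * ennreal (norm (x :: 'a) powr a * exp (- (norm x)\<^sup>2 / 2)) \<partial>lborel)"
    unfolding gaussian_def
    by (subst nn_integral_density) (auto simp: prod_std_normal_density ennreal_mult[symmetric] mult_ac)
  also have "\<dots> = ennreal ?c * ennreal (radial_const DIM('a) * (2 powr (a / 2) * Gamma ((real DIM('a) + a) / 2)))"
    by (subst nn_integral_cmult, measurable) (subst nn_integral_norm_powr_gaussian, use assms in auto)
  finally show "(\<integral>\<^sup>+x. ennreal (norm (x :: 'a) powr a) \<partial>gaussian) = ennreal (?c * (radial_const DIM('a) * (2 powr (a / 2) * Gamma ((real DIM('a) + a) / 2))))"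
    by (simp add: ennreal_mult')
  have "0 \<le> Gamma ((real DIM('a) + a) / 2)"
    using assms by (intro less_imp_le Gamma_real_pos) simp
  then show "0 \<le> ?c * (radial_const DIM('a) * (2 powr (a / 2) * Gamma ((real DIM('a) + a) / 2)))"
    using radial_const_pos[of "DIM('a)"] by (simp add: less_imp_le)
qed auto

text \<open>
  Fubini in the form used throughout: finite measures and a bounded kernel, so that integrability on the
  product need not be discussed.
\<close>
lemma integral_Fubini_bounded:
  fixes f :: "'a \<Rightarrow> 'b \<Rightarrow> real"
  assumes "finite_measure M" "finite_measure N"
    and [measurable]: "case_prod f \<in> borel_measurable (M \<Otimes>\<^sub>M N)"
    and bound: "\<And>x y. \<bar>f x y\<bar> \<le> B"
  shows "(\<integral>x. (\<integral>y. f x y \<partial>N) \<partial>M) = (\<integral>y. (\<integral>x. f x y \<partial>M) \<partial>N)"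
proof -
  interpret M: finite_measure M by fact
  interpret N: finite_measure N by fact
  interpret pair_sigma_finite M N ..
  interpret P: finite_measure "M \<Otimes>\<^sub>M N"
    by (rule finite_measure_pair_measure) fact+
  have "integrable (M \<Otimes>\<^sub>M N) (case_prod f)"
    by (rule P.integrable_const_bound[where B=B]) (auto simp: bound)
  then show ?thesis
    by (rule Fubini_integral[symmetric])
qed

text \<open>
  Averaging the compensated characteristic function over Gaussian frequencies replaces the oscillating
  kernel by a monotone function of the norm. This turns a statement about characteristic functions on a
  Euclidean space into one about Laplace transforms of a radial variable.
\<close>
lemma integral_one_minus_gaussian:
  fixes \<mu> :: "'a::euclidean_space measure"
  assumes "finite_measure \<mu>" and sets[measurable_cong]: "sets \<mu> = sets borel" and s: "0 \<le> s"
  shows "(\<integral>y. 1 - exp (- s * ((norm y)\<^sup>2 / 2)) \<partial>\<mu>) =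
    (\<integral>x. (\<integral>y. 1 - cos ((sqrt s *\<^sub>R x) \<bullet> y) \<partial>\<mu>) \<partial>gaussian)"
proof -
  interpret g: prob_space "gaussian :: 'a measure" by (rule prob_space_gaussian)
  have b: "\<bar>1 - cos (x :: real)\<bar> \<le> 2" for x
    using cos_ge_minus_one[of x] cos_le_one[of x] by linarith
  have "1 - exp (- s * ((norm y)\<^sup>2 / 2)) = (\<integral>x. 1 - cos ((sqrt s *\<^sub>R x) \<bullet> y) \<partial>gaussian)" for y :: 'a
  proof -
    have "(\<integral>x. cos ((sqrt s *\<^sub>R y) \<bullet> x) \<partial>gaussian) = exp (- s * ((norm y)\<^sup>2 / 2))"
      unfolding integral_cos_gaussian using s by (simp add: power_mult_distrib)
    moreover have "integrable gaussian (\<lambda>x. cos ((sqrt s *\<^sub>R y) \<bullet> x))"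
      by (rule g.integrable_const_bound[where B=1]) auto
    ultimately show ?thesis
      by (simp add: inner_commute g.prob_space[simplified])
  qed
  then have "(\<integral>y. 1 - exp (- s * ((norm y)\<^sup>2 / 2)) \<partial>\<mu>) = (\<integral>y. (\<integral>x. 1 - cos ((sqrt s *\<^sub>R x) \<bullet> y) \<partial>gaussian) \<partial>\<mu>)"
    by simp
  also have "\<dots> = (\<integral>x. (\<integral>y. 1 - cos ((sqrt s *\<^sub>R x) \<bullet> y) \<partial>\<mu>) \<partial>gaussian)"
    by (rule integral_Fubini_bounded[OF assms(1) g.finite_measure_axioms, where B=2]) (use b in auto)
  finally show ?thesis .
qed

section \<open>The stable jump density\<close>

lemma density_const_pos:
  assumes "0 < \<alpha>" "\<alpha> < 2"
  shows "0 < density_const d \<alpha>"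
  unfolding density_const_def
  using assms by (intro mult_pos_pos Gamma_real_pos sin_gt_zero) (auto intro: add_nonneg_pos)

lemma Gamma_reflection_real: "Gamma x * Gamma (1 - x) = pi / sin (pi * x)" for x :: real
proof -
  have "complex_of_real (Gamma x * Gamma (1 - x)) = complex_of_real (pi / sin (pi * x))"
    using Gamma_reflection_complex[of "complex_of_real x"]
    by (simp add: Gamma_complex_of_real[symmetric] sin_of_real[symmetric])
  then show ?thesis
    by (simp only: of_real_eq_iff)
qed

text \<open>
  This identity explains the constant: the left side is the Laplace exponent of the jump density with
  factor \<open>density_const\<close>, the right side the Gaussian moment of order \<alpha>. They agree by the
  reflection formula Gamma (\<alpha> / 2) * Gamma (1 - \<alpha> / 2) = pi / sin (pi * \<alpha> / 2).
\<close>
lemma density_const_reflection: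
  assumes "0 < \<alpha>" "\<alpha> < 2"
  shows "density_const d \<alpha> * (2 powr (- (real d + \<alpha>) / 2) * (2 / \<alpha> * Gamma (1 - \<alpha> / 2))) =
    (2 * pi) powr (- real d / 2) * (2 powr (\<alpha> / 2) * Gamma ((real d + \<alpha>) / 2))"
proof -
  have "0 < sin (\<alpha> * pi / 2)"
    using assms by (intro sin_gt_zero) auto
  then have refl: "sin (\<alpha> * pi / 2) * (Gamma (\<alpha> / 2) * Gamma (1 - \<alpha> / 2)) = pi"
    using Gamma_reflection_real[of "\<alpha> / 2"] by (simp add: mult_ac)
  have "density_const d \<alpha> * (2 powr (- (real d + \<alpha>) / 2) * (2 / \<alpha> * Gamma (1 - \<alpha> / 2))) =
    (2 powr (\<alpha> - 1) * 2 * 2 powr (- (real d + \<alpha>) / 2)) * pi powr (- real d / 2 - 1)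
      * (sin (\<alpha> * pi / 2) * (Gamma (\<alpha> / 2) * Gamma (1 - \<alpha> / 2))) * Gamma ((real d + \<alpha>) / 2)"
    using assms unfolding density_const_def by simp
  also have "2 powr (\<alpha> - 1) * 2 * 2 powr (- (real d + \<alpha>) / 2) = 2 powr (- real d / 2) * 2 powr (\<alpha> / 2)"
  proof -
    have "2 powr (\<alpha> - 1) * 2 = 2 powr \<alpha>" by (simp add: powr_diff)
    then show ?thesis
      unfolding powr_add[symmetric] by (simp only: powr_add[symmetric]) (rule arg_cong[where f="(powr) 2"], simp add: field_simps)
  qed
  also have "2 powr (- real d / 2) * 2 powr (\<alpha> / 2) * pi powr (- real d / 2 - 1) * (sin (\<alpha> * pi / 2) * (Gamma (\<alpha> / 2) * Gamma (1 - \<alpha> / 2))) =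
      2 powr (- real d / 2) * 2 powr (\<alpha> / 2) * pi powr (- real d / 2)"
    unfolding refl by (simp add: powr_diff)
  finally show ?thesis
    by (simp add: powr_mult)
qed

text \<open>
  Identification of the limit: the measure with density \<open>density_const\<close> times |x| powr (- d - \<alpha>) has the
  same Gaussian averages as the exponent |x| powr \<alpha>. The common factor \<open>radial_const\<close> cancels.
\<close>
lemma has_bochner_integral_stable:
  fixes \<alpha> s :: real
  assumes \<alpha>: "0 < \<alpha>" "\<alpha> < 2" and s: "0 \<le> s"
  shows "has_bochner_integral lborel
    (\<lambda>x :: 'a::euclidean_space. density_const DIM('a) \<alpha> * ((1 - exp (- s * ((norm x)\<^sup>2 / 2))) * norm x powr (- real DIM('a) - \<alpha>)))
    (s powr (\<alpha> / 2) * (\<integral>x. norm (x :: 'a) powr \<alpha> \<partial>gaussian))"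
proof (cases "s = 0")
  case False
  with s have s: "0 < s" by simp
  let ?c = "density_const DIM('a) \<alpha>" and ?d = "real DIM('a)" and ?K = "radial_const DIM('a)"
  have c: "0 < ?c" by (rule density_const_pos) fact+
  have K: "0 < ?K" by (rule radial_const_pos) simp
  have G: "0 < Gamma (1 - \<alpha> / 2)" using \<alpha> by (intro Gamma_real_pos) simp
  have mom: "(\<integral>x. norm (x :: 'a) powr \<alpha> \<partial>gaussian) = (2 * pi) powr (- ?d / 2) * (?K * (2 powr (\<alpha> / 2) * Gamma ((?d + \<alpha>) / 2)))"
    by (rule has_bochner_integral_integral_eq, rule has_bochner_integral_norm_powr_gaussian) (use \<alpha> in simp)
  have nn: "(\<integral>\<^sup>+x. ennreal (?c * ((1 - exp (- s * ((norm (x :: 'a))\<^sup>2 / 2))) * norm x powr (- ?d - \<alpha>))) \<partial>lborel) =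
     ennreal (?c * (?K * (2 powr (- (?d + \<alpha>) / 2) * (2 / \<alpha> * s powr (\<alpha> / 2) * Gamma (1 - \<alpha> / 2)))))"
  proof -
    have "(\<integral>\<^sup>+x. ennreal (?c * ((1 - exp (- s * ((norm (x :: 'a))\<^sup>2 / 2))) * norm x powr (- ?d - \<alpha>))) \<partial>lborel) =
      (\<integral>\<^sup>+x. ennreal ?c * ennreal ((1 - exp (- s * ((norm (x :: 'a))\<^sup>2 / 2))) * norm x powr (- ?d - \<alpha>)) \<partial>lborel)"
      using c by (intro nn_integral_cong ennreal_mult') simp
    also have "\<dots> = ennreal ?c * ennreal (?K * (2 powr (- (?d + \<alpha>) / 2) * (2 / \<alpha> * s powr (\<alpha> / 2) * Gamma (1 - \<alpha> / 2))))"
      by (subst nn_integral_cmult, measurable) (subst nn_integral_stable[OF \<alpha> s], rule refl)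
    finally show ?thesis
      using c by (simp only: ennreal_mult'[OF less_imp_le])
  qed
  have "?c * (?K * (2 powr (- (?d + \<alpha>) / 2) * (2 / \<alpha> * s powr (\<alpha> / 2) * Gamma (1 - \<alpha> / 2)))) =
     s powr (\<alpha> / 2) * ?K * (?c * (2 powr (- (?d + \<alpha>) / 2) * (2 / \<alpha> * Gamma (1 - \<alpha> / 2))))"
    by simp
  also have "\<dots> = s powr (\<alpha> / 2) * (\<integral>x. norm (x :: 'a) powr \<alpha> \<partial>gaussian)"
    unfolding density_const_reflection[OF \<alpha>] mom by simp
  finally have val: "?c * (?K * (2 powr (- (?d + \<alpha>) / 2) * (2 / \<alpha> * s powr (\<alpha> / 2) * Gamma (1 - \<alpha> / 2)))) =
     s powr (\<alpha> / 2) * (\<integral>x. norm (x :: 'a) powr \<alpha> \<partial>gaussian)" .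
  show ?thesis
    using nn unfolding val
    by (intro has_bochner_integral_nn_integral) (use c s in \<open>auto intro!: mult_nonneg_nonneg\<close>)
qed (use \<alpha> in \<open>simp add: has_bochner_integral_zero\<close>)

section \<open>Truncated second moments\<close>

lemma one_minus_cos_ge:
  fixes x :: real
  assumes "\<bar>x\<bar> \<le> 2"
  shows "x\<^sup>2 / 3 \<le> 1 - cos x"
proof (cases "x = 0")
  case False
  then obtain t where t: "cos \<bar>x\<bar> = (\<Sum>m<4. cos_coeff m * \<bar>x\<bar> ^ m) + cos (t + 1/2 * real 4 * pi) / fact 4 * \<bar>x\<bar> ^ 4"
    using Maclaurin_cos_expansion2[of "\<bar>x\<bar>" 4] by auto
  have "(\<Sum>m<4. cos_coeff m * \<bar>x\<bar> ^ m) = 1 - x\<^sup>2 / 2"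
    by (simp add: lessThan_nat_numeral lessThan_Suc cos_coeff_def)
  moreover have "cos (t + 1/2 * real 4 * pi) / fact 4 * \<bar>x\<bar> ^ 4 \<le> 1 / 24 * \<bar>x\<bar> ^ 4"
    by (intro mult_right_mono) (auto simp: fact_numeral)
  moreover have "\<bar>x\<bar> ^ 4 = x\<^sup>2 * x\<^sup>2"
    by (simp add: power_mult[symmetric] flip: power_add)
  moreover have "x\<^sup>2 \<le> 4"
    using assms power_mono[of "\<bar>x\<bar>" 2 2] by simp
  then have "x\<^sup>2 * x\<^sup>2 \<le> 4 * x\<^sup>2"
    by (intro mult_right_mono) auto
  ultimately show ?thesis
    using t by simp
qed simp

lemma one_minus_cos_le: "1 - cos x \<le> x\<^sup>2 / 2" for x :: real
proof -
  have "(sin (x / 2))\<^sup>2 \<le> (x / 2)\<^sup>2"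
    using abs_sin_x_le_abs_x[of "x / 2"] by (simp only: abs_le_square_iff)
  then show ?thesis
    using cos_double_sin[of "x / 2"] by (simp add: power_divide)
qed

text \<open>
  A single frequency cannot detect the points where the cosine equals 1, but the average over any large
  set E of frequencies controls the truncated second moment, with a constant that does not depend on E.
\<close>
lemma integral_one_minus_cos_ge:
  fixes a :: real
  assumes E[measurable]: "E \<in> sets borel" and sub: "E \<subseteq> {0..1}" and big: "7 / 8 \<le> measure lborel E"
  shows "min 1 (a\<^sup>2) / 32 \<le> (\<integral>l. indicator E l * (1 - cos (l * a)) \<partial>lborel)"
proof -
  have fin: "emeasure lborel A < \<infinity>" if "A \<subseteq> {0..1}" for A :: "real set"
  proof -
    have "emeasure lborel A \<le> emeasure lborel {0..1::real}"
      by (rule emeasure_mono) (use that in auto)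
    also have "\<dots> < \<infinity>" by simp
    finally show ?thesis .
  qed
  have ind: "integrable lborel (\<lambda>l. indicator A l :: real)" if "A \<in> sets borel" "A \<subseteq> {0..1}" for A :: "real set"
    using that fin by (intro integrable_real_indicator) auto
  have int: "integrable lborel (\<lambda>l. indicator A l * (1 - cos (l * a)))" if "A \<in> sets borel" "A \<subseteq> {0..1}" for A
  proof (rule Bochner_Integration.integrable_bound[OF integrable_mult_left[OF ind[OF that], of 2]])
    have "1 - cos (l * a) \<le> 2" for l
      using cos_ge_minus_one[of "l * a"] by linarith
    then show "AE l in lborel. norm (indicator A l * (1 - cos (l * a))) \<le> norm (indicator A l * 2 :: real)"
      by (auto split: split_indicator)
  qed (use that in measurable)
  show ?thesis
  proof (cases "\<bar>a\<bar> \<le> 2")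
    case True
    \<comment> \<open>The quadratic lower bound applies on all of [0,1]; at least 3/8 of the length of E lies in [1/2,1],
      where the factor l cannot spoil it.\<close>
    let ?F = "E \<inter> {1/2..1}"
    have "measure lborel E \<le> measure lborel (?F \<union> {0..1/2})"
      by (rule measure_mono_fmeasurable) (use sub fin in \<open>auto simp: fmeasurable_def subset_iff\<close>)
    also have "\<dots> \<le> measure lborel ?F + measure lborel {0..1/2::real}"
      by (rule measure_Un_le) auto
    finally have "3 / 8 \<le> measure lborel ?F"
      using big by simp
    then have "3 / 8 * (a\<^sup>2 / 12) \<le> measure lborel ?F * (a\<^sup>2 / 12)"
      by (rule mult_right_mono) simp
    also have "\<dots> = (\<integral>l. indicator ?F l * (a\<^sup>2 / 12) \<partial>lborel)"
      by simp
    also have "\<dots> \<le> (\<integral>l. indicator E l * (1 - cos (l * a)) \<partial>lborel)"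
    proof (rule integral_mono)
      show "integrable lborel (\<lambda>l. indicator ?F l * (a\<^sup>2 / 12))"
        by (intro integrable_mult_left ind) auto
      show "integrable lborel (\<lambda>l. indicator E l * (1 - cos (l * a)))"
        by (rule int) (use sub in auto)
      fix l
      have "a\<^sup>2 / 12 \<le> 1 - cos (l * a)" if "1/2 \<le> l" "l \<le> 1"
      proof -
        have "\<bar>l * a\<bar> \<le> 1 * 2"
          unfolding abs_mult using that True by (intro mult_mono) auto
        then have "(l * a)\<^sup>2 / 3 \<le> 1 - cos (l * a)"
          by (intro one_minus_cos_ge) simp
        moreover have "(1/2)\<^sup>2 * a\<^sup>2 \<le> (l * a)\<^sup>2"
          unfolding power_mult_distrib using that by (intro mult_right_mono power_mono) auto
        ultimately show ?thesis by (simp add: power2_eq_square)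
      qed
      then show "indicator ?F l * (a\<^sup>2 / 12) \<le> indicator E l * (1 - cos (l * a))"
        by (auto split: split_indicator)
    qed
    finally show ?thesis by simp
  next
    case False
    then have a: "a \<noteq> 0" "2 < \<bar>a\<bar>" by auto
    \<comment> \<open>The full average over [0,1] is at least 1/2, and the part of [0,1] outside E costs at most 2 * 1/8.\<close>
    have sinc: "(\<integral>l. indicator {0..1} l *\<^sub>R (1 - cos (l * a)) \<partial>lborel) = (1 - sin (1 * a) / a) - (0 - sin (0 * a) / a)"
      by (rule integral_FTC_Icc)
        (use a in \<open>auto intro!: derivative_eq_intros continuous_intros simp: has_real_derivative_iff_has_vector_derivative[symmetric]\<close>)
    have "\<bar>sin a / a\<bar> \<le> 1 / 2"
      unfolding abs_divide by (rule frac_le) (use a in auto)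
    then have "sin a / a \<le> 1 / 2"
      by (rule order_trans[OF abs_ge_self])
    then have "1 / 4 \<le> (1 - sin a / a) - 2 * (1 - measure lborel E)"
      using big by argo
    also have "\<dots> = (\<integral>l. indicator {0..1} l * (1 - cos (l * a)) - 2 * (indicator {0..1} l - indicator E l) \<partial>lborel)"
      using sinc by (simp add: ind int sub)
    also have "\<dots> \<le> (\<integral>l. indicator E l * (1 - cos (l * a)) \<partial>lborel)"
    proof (rule integral_mono)
      show "integrable lborel (\<lambda>l. indicator {0..1} l * (1 - cos (l * a)) - 2 * (indicator {0..1} l - indicator E l))"
        using ind int sub by simp
      show "integrable lborel (\<lambda>l. indicator E l * (1 - cos (l * a)))"
        by (rule int) (use sub in auto)
      show "indicator {0..1} l * (1 - cos (l * a)) - 2 * (indicator {0..1} l - indicator E l) \<le> indicator E l * (1 - cos (l * a))" for l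
        using sub cos_ge_minus_one[of "l * a"] by (auto split: split_indicator)
    qed
    finally show ?thesis by simp
  qed
qed

text \<open>
  Pointwise bounds on the characteristic functions, each valid only from some index on, give a uniform
  bound on truncated second moments. This is an Egorov argument: from some index on the bound holds
  simultaneously for a set of frequencies of length at least 7/8, and \<open>integral_one_minus_cos_ge\<close> needs no more.
  It takes the place of uniform convergence or Potter bounds for regularly varying functions.
\<close>
lemma eventually_truncated_moment_le:
  fixes \<mu> :: "nat \<Rightarrow> 'a::euclidean_space measure" and e :: 'a and a :: "nat \<Rightarrow> real"
  assumes prob: "\<And>n. prob_space (\<mu> n)" and sets[measurable_cong]: "\<And>n. sets (\<mu> n) = sets borel"
    and pos: "\<And>n. 0 < a n"
    and ev: "\<And>l. l \<in> {0..1} \<Longrightarrow> \<forall>\<^sub>F n in sequentially. (\<integral>y. 1 - cos (l * (e \<bullet> y)) \<partial>\<mu> n) \<le> 2 * a n"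
  shows "\<forall>\<^sub>F n in sequentially. (\<integral>y. min 1 ((e \<bullet> y)\<^sup>2) \<partial>\<mu> n) \<le> 64 * a n"
proof -
  define D where "D n l = (\<integral>y. 1 - cos (l * (e \<bullet> y)) \<partial>\<mu> n)" for n l
  define E where "E N = {l \<in> {0..1}. \<forall>n\<ge>N. D n l \<le> 2 * a n}" for N :: nat
  have [measurable]: "D n \<in> borel_measurable borel" for n
  proof -
    interpret prob_space "\<mu> n" by (rule prob)
    show ?thesis unfolding D_def by measurable
  qed
  have E[measurable]: "E N \<in> sets borel" for N
    unfolding E_def by measurable
  \<comment> \<open>The good sets increase to the whole interval, so one of them already has length above 7/8.\<close>
  have "(\<lambda>N. emeasure lborel (E N)) \<longlonglongrightarrow> emeasure lborel (\<Union>N. E N)"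
    by (rule Lim_emeasure_incseq) (auto simp: incseq_def E_def)
  also have "(\<Union>N. E N) = {0..1}"
    using ev unfolding E_def D_def eventually_sequentially by blast
  finally have "(\<lambda>N. emeasure lborel (E N)) \<longlonglongrightarrow> 1" by simp
  then have "\<forall>\<^sub>F N in sequentially. ennreal (7 / 8) < emeasure lborel (E N)"
    by (rule order_tendstoD(1)) (simp add: ennreal_less_one_iff)
  then obtain N where N: "ennreal (7 / 8) < emeasure lborel (E N)"
    by (auto simp: eventually_sequentially)
  have le1: "emeasure lborel (E N) \<le> 1"
  proof -
    have "E N \<subseteq> {0..1}" by (auto simp: E_def)
    then have "emeasure lborel (E N) \<le> emeasure lborel {0..1::real}" by (rule emeasure_mono) simp
    then show ?thesis by simp
  qed
  then have fin: "emeasure lborel (E N) < \<infinity>"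
    by (rule le_less_trans) simp
  then have meas: "emeasure lborel (E N) = ennreal (measure lborel (E N))"
    by (intro emeasure_eq_ennreal_measure) auto
  have big: "7 / 8 \<le> measure lborel (E N)" and small: "measure lborel (E N) \<le> 1"
    using N le1 unfolding meas by (auto simp: ennreal_less_iff)
  define \<kappa> where "\<kappa> = density lborel (\<lambda>l. ennreal (indicator (E N) l))"
  have [measurable_cong]: "sets \<kappa> = sets borel" by (simp add: \<kappa>_def)
  have k: "finite_measure \<kappa>"
    using fin by (intro finite_measureI) (simp add: \<kappa>_def emeasure_density ennreal_indicator)
  have int_k: "(\<integral>l. f l \<partial>\<kappa>) = (\<integral>l. indicator (E N) l * f l \<partial>lborel)" if "f \<in> borel_measurable borel" for f :: "real \<Rightarrow> real"
    unfolding \<kappa>_def using that by (subst integral_density) auto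
  have "(\<integral>y. min 1 ((e \<bullet> y)\<^sup>2) \<partial>\<mu> n) \<le> 64 * a n" if n: "N \<le> n" for n
  proof -
    interpret prob_space "\<mu> n" by (rule prob)
    have b: "\<bar>1 - cos (x :: real)\<bar> \<le> 2" for x
      using cos_ge_minus_one[of x] cos_le_one[of x] by linarith
    have "(\<integral>y. min 1 ((e \<bullet> y)\<^sup>2) \<partial>\<mu> n) / 32 = (\<integral>y. min 1 ((e \<bullet> y)\<^sup>2) / 32 \<partial>\<mu> n)"
      by simp
    also have "\<dots> \<le> (\<integral>y. (\<integral>l. 1 - cos (l * (e \<bullet> y)) \<partial>\<kappa>) \<partial>\<mu> n)"
    proof (rule integral_mono)
      show "integrable (\<mu> n) (\<lambda>y. min 1 ((e \<bullet> y)\<^sup>2) / 32)"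
        by (rule integrable_const_bound[where B=1]) auto
      show "integrable (\<mu> n) (\<lambda>y. \<integral>l. 1 - cos (l * (e \<bullet> y)) \<partial>\<kappa>)"
      proof (rule integrable_const_bound[where B="2 * measure \<kappa> (space \<kappa>)"])
        interpret k: finite_measure \<kappa> by (rule k)
        show "(\<lambda>y. \<integral>l. 1 - cos (l * (e \<bullet> y)) \<partial>\<kappa>) \<in> borel_measurable (\<mu> n)"
          by measurable
        have "norm (\<integral>l. 1 - cos (l * (e \<bullet> y)) \<partial>\<kappa>) \<le> (\<integral>l. 2 \<partial>\<kappa>)" for y
        proof (rule Bochner_Integration.integral_norm_bound_integral)
          show "integrable \<kappa> (\<lambda>l. 1 - cos (l * (e \<bullet> y)))"
            by (rule k.integrable_const_bound[where B=2]) (auto simp: b)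
        qed (auto simp: b)
        then show "AE y in \<mu> n. norm (\<integral>l. 1 - cos (l * (e \<bullet> y)) \<partial>\<kappa>) \<le> 2 * measure \<kappa> (space \<kappa>)"
          by (simp add: mult.commute)
      qed
      show "min 1 ((e \<bullet> y)\<^sup>2) / 32 \<le> (\<integral>l. 1 - cos (l * (e \<bullet> y)) \<partial>\<kappa>)" for y
        by (subst int_k, measurable) (rule integral_one_minus_cos_ge[OF E _ big], auto simp: E_def)
    qed
    also have "\<dots> = (\<integral>l. D n l \<partial>\<kappa>)"
      unfolding D_def
      by (rule integral_Fubini_bounded[OF _ k, where B=2]) (auto simp: b intro: finite_measure_axioms)
    also have "\<dots> = (\<integral>l. indicator (E N) l * D n l \<partial>lborel)"
      by (rule int_k) measurable
    also have "\<dots> \<le> (\<integral>l. indicator (E N) l * (2 * a n) \<partial>lborel)"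
    proof (rule integral_mono_AE')
      show "integrable lborel (\<lambda>l. indicator (E N) l * (2 * a n))"
        using fin by (intro integrable_mult_left integrable_real_indicator) auto
      show "AE l in lborel. indicator (E N) l * D n l \<le> indicator (E N) l * (2 * a n)"
        using n by (auto simp: E_def split: split_indicator)
      show "AE l in lborel. 0 \<le> indicator (E N) l * (2 * a n)"
        using pos[of n] by (auto simp: less_imp_le)
    qed
    also have "\<dots> = measure lborel (E N) * (2 * a n)"
      by simp
    also have "\<dots> \<le> 1 * (2 * a n)"
      using pos[of n] small by (intro mult_right_mono) auto
    finally show ?thesis by simp
  qed
  then show ?thesis
    by (auto simp: eventually_sequentially)
qed

section \<open>Convergence of measures from convergence of exponents\<close>

text \<open>
  The bound that carries truncated second moments in the coordinate directions over to all frequencies,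
  with quadratic growth in the frequency.
\<close>
lemma one_minus_cos_inner_le:
  fixes x y :: "'a::euclidean_space"
  shows "1 - cos (x \<bullet> y) \<le> 2 * (1 + (norm x)\<^sup>2) * (\<Sum>b\<in>Basis. min 1 ((b \<bullet> y)\<^sup>2))"
proof -
  have "1 - cos (x \<bullet> y) \<le> 2 * (1 + (norm x)\<^sup>2) * min 1 ((norm y)\<^sup>2)"
  proof (cases "(norm y)\<^sup>2 \<le> 1")
    case True
    have "1 - cos (x \<bullet> y) \<le> (x \<bullet> y)\<^sup>2 / 2" by (rule one_minus_cos_le)
    also have "(x \<bullet> y)\<^sup>2 \<le> (norm x)\<^sup>2 * (norm y)\<^sup>2"
      using Cauchy_Schwarz_ineq[of x y] by (simp add: power2_norm_eq_inner)
    also have "(norm x)\<^sup>2 * (norm y)\<^sup>2 / 2 \<le> 2 * (1 + (norm x)\<^sup>2) * (norm y)\<^sup>2"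
      by (simp add: algebra_simps)
    finally show ?thesis using True by (simp add: divide_right_mono)
  next
    case False
    have "1 - cos (x \<bullet> y) \<le> 2" using cos_ge_minus_one[of "x \<bullet> y"] by linarith
    then show ?thesis using False by (simp add: add_increasing2)
  qed
  also have "min 1 ((norm y)\<^sup>2) \<le> (\<Sum>b\<in>Basis. min 1 ((b \<bullet> y)\<^sup>2))"
  proof (cases "\<exists>b\<in>Basis. 1 \<le> (b \<bullet> y)\<^sup>2")
    case True
    then obtain b where b: "b \<in> Basis" "1 \<le> (b \<bullet> y)\<^sup>2" by auto
    have "min 1 ((b \<bullet> y)\<^sup>2) \<le> (\<Sum>b\<in>Basis. min 1 ((b \<bullet> y)\<^sup>2))"
      by (rule member_le_sum) (use b in auto)
    then show ?thesis using b by simp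
  next
    case False
    then have "(\<Sum>b\<in>Basis. min 1 ((b \<bullet> y)\<^sup>2)) = (norm y)\<^sup>2"
      unfolding norm_square_eq_sum by (intro sum.cong) (auto simp: inner_commute not_le min_def)
    then show ?thesis by simp
  qed
  finally show ?thesis by (simp add: mult_left_mono)
qed

text \<open>
  Pointwise convergence of the exponents survives Gaussian averaging by dominated convergence; the
  domination comes from \<open>eventually_truncated_moment_le\<close> in the coordinate directions.
\<close>
lemma tendsto_integral_one_minus_gaussian:
  fixes \<mu> :: "nat \<Rightarrow> 'a::euclidean_space measure" and a :: "nat \<Rightarrow> real"
  assumes prob: "\<And>n. prob_space (\<mu> n)" and sets[measurable_cong]: "\<And>n. sets (\<mu> n) = sets borel"
    and pos: "\<And>n. 0 < a n" and \<alpha>: "0 < \<alpha>"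
    and lim: "\<And>x. (\<lambda>n. (\<integral>y. 1 - cos (x \<bullet> y) \<partial>\<mu> n) / a n) \<longlonglongrightarrow> norm x powr \<alpha>"
    and s: "0 \<le> s"
  shows "(\<lambda>n. (\<integral>y. 1 - exp (- s * ((norm y)\<^sup>2 / 2)) \<partial>\<mu> n) / a n) \<longlonglongrightarrow>
    s powr (\<alpha> / 2) * (\<integral>x. norm (x :: 'a) powr \<alpha> \<partial>gaussian)"
proof -
  define \<Phi> where "\<Phi> n x = (\<integral>y. 1 - cos (x \<bullet> y) \<partial>\<mu> n) / a n" for n and x :: 'a
  have "\<forall>\<^sub>F n in sequentially. \<forall>b\<in>(Basis :: 'a set). (\<integral>y. min 1 ((b \<bullet> y)\<^sup>2) \<partial>\<mu> n) \<le> 64 * a n"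
  proof (rule eventually_ball_finite[OF finite_Basis], rule ballI)
    fix b :: 'a assume b: "b \<in> Basis"
    show "\<forall>\<^sub>F n in sequentially. (\<integral>y. min 1 ((b \<bullet> y)\<^sup>2) \<partial>\<mu> n) \<le> 64 * a n"
    proof (rule eventually_truncated_moment_le[OF prob sets pos])
      fix l :: real assume l: "l \<in> {0..1}"
      have "norm (l *\<^sub>R b) powr \<alpha> \<le> 1 powr \<alpha>"
        using l b \<alpha> by (intro powr_mono2) auto
      then have "norm (l *\<^sub>R b) powr \<alpha> < 2" by simp
      then have "\<forall>\<^sub>F n in sequentially. (\<integral>y. 1 - cos ((l *\<^sub>R b) \<bullet> y) \<partial>\<mu> n) / a n < 2"
        by (rule order_tendstoD(2)[OF lim])
      then show "\<forall>\<^sub>F n in sequentially. (\<integral>y. 1 - cos (l * (b \<bullet> y)) \<partial>\<mu> n) \<le> 2 * a n"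
        by (rule eventually_mono) (use pos in \<open>simp add: divide_less_eq\<close>)
    qed
  qed
  then obtain N where N: "\<And>n b. N \<le> n \<Longrightarrow> b \<in> Basis \<Longrightarrow> (\<integral>y. min 1 (((b :: 'a) \<bullet> y)\<^sup>2) \<partial>\<mu> n) \<le> 64 * a n"
    by (auto simp: eventually_sequentially)
  \<comment> \<open>A dominating function for the exponents: quadratic growth is integrable against the Gaussian.\<close>
  have dom: "\<Phi> n x \<le> 128 * DIM('a) * (1 + (norm x)\<^sup>2)" if n: "N \<le> n" for n and x :: 'a
  proof -
    interpret prob_space "\<mu> n" by (rule prob)
    have int: "integrable (\<mu> n) (\<lambda>y. min 1 ((b \<bullet> y)\<^sup>2))" for b :: 'a
      by (rule integrable_const_bound[where B=1]) auto
    have "(\<integral>y. 1 - cos (x \<bullet> y) \<partial>\<mu> n) \<le> (\<integral>y. 2 * (1 + (norm x)\<^sup>2) * (\<Sum>b\<in>Basis. min 1 ((b \<bullet> y)\<^sup>2)) \<partial>\<mu> n)"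
    proof (rule integral_mono_AE')
      show "integrable (\<mu> n) (\<lambda>y. 2 * (1 + (norm x)\<^sup>2) * (\<Sum>b\<in>Basis. min 1 ((b \<bullet> y)\<^sup>2)))"
        by (intro integrable_mult_right Bochner_Integration.integrable_sum int)
      show "AE y in \<mu> n. 1 - cos (x \<bullet> y) \<le> 2 * (1 + (norm x)\<^sup>2) * (\<Sum>b\<in>Basis. min 1 ((b \<bullet> y)\<^sup>2))"
        by (intro AE_I2 one_minus_cos_inner_le)
      show "AE y in \<mu> n. 0 \<le> 2 * (1 + (norm x)\<^sup>2) * (\<Sum>b\<in>Basis. min 1 ((b \<bullet> y)\<^sup>2))"
        by (intro AE_I2 mult_nonneg_nonneg sum_nonneg) auto
    qed
    also have "\<dots> = 2 * (1 + (norm x)\<^sup>2) * (\<Sum>b\<in>Basis. \<integral>y. min 1 ((b \<bullet> y)\<^sup>2) \<partial>\<mu> n)"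
      by (simp add: integral_sum int)
    also have "\<dots> \<le> 2 * (1 + (norm x)\<^sup>2) * (\<Sum>b\<in>(Basis :: 'a set). 64 * a n)"
      by (intro mult_left_mono sum_mono N n) (auto intro: add_nonneg_nonneg)
    also have "\<dots> = 128 * DIM('a) * (1 + (norm x)\<^sup>2) * a n"
      by simp
    finally show ?thesis
      using pos[of n] by (simp add: \<Phi>_def divide_le_eq)
  qed
  have nonneg: "0 \<le> \<Phi> n x" for n and x :: 'a
    using pos[of n] by (auto simp: \<Phi>_def intro!: divide_nonneg_nonneg integral_nonneg_AE)
  have [measurable]: "\<Phi> n \<in> borel_measurable borel" for n
  proof -
    interpret prob_space "\<mu> n" by (rule prob)
    show ?thesis unfolding \<Phi>_def by measurable
  qed
  have "(\<lambda>n. \<integral>x. \<Phi> (n + N) (sqrt s *\<^sub>R x) \<partial>gaussian) \<longlonglongrightarrow> (\<integral>x. norm (sqrt s *\<^sub>R (x :: 'a)) powr \<alpha> \<partial>gaussian)"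
  proof (rule integral_dominated_convergence)
    interpret g: prob_space "gaussian :: 'a measure" by (rule prob_space_gaussian)
    show "integrable gaussian (\<lambda>x :: 'a. 128 * DIM('a) * (1 + s * norm x powr 2))"
      using has_bochner_integral_norm_powr_gaussian[of 2, where 'a='a]
      by (auto intro!: integrable_mult_right Bochner_Integration.integrable_add simp: has_bochner_integral_iff)
    have "norm (\<Phi> (n + N) (sqrt s *\<^sub>R x)) \<le> 128 * DIM('a) * (1 + s * norm x powr 2)" for n and x :: 'a
      using dom[of "n + N" "sqrt s *\<^sub>R x"] nonneg s by (simp add: power_mult_distrib)
    then show "AE x in gaussian. norm (\<Phi> (n + N) (sqrt s *\<^sub>R x)) \<le> 128 * DIM('a) * (1 + s * norm x powr 2)" for n
      by simp
    show "AE x :: 'a in gaussian. (\<lambda>n. \<Phi> (n + N) (sqrt s *\<^sub>R x)) \<longlonglongrightarrow> norm (sqrt s *\<^sub>R x) powr \<alpha>"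
      unfolding \<Phi>_def by (intro AE_I2 LIMSEQ_ignore_initial_segment lim)
  qed auto
  then have "(\<lambda>n. \<integral>x. \<Phi> n (sqrt s *\<^sub>R x) \<partial>gaussian) \<longlonglongrightarrow> (\<integral>x. norm (sqrt s *\<^sub>R (x :: 'a)) powr \<alpha> \<partial>gaussian)"
    by (rule LIMSEQ_offset)
  moreover have "(\<integral>x. \<Phi> n (sqrt s *\<^sub>R x) \<partial>gaussian) = (\<integral>y. 1 - exp (- s * ((norm y)\<^sup>2 / 2)) \<partial>\<mu> n) / a n" for n
  proof -
    interpret prob_space "\<mu> n" by (rule prob)
    show ?thesis
      unfolding integral_one_minus_gaussian[OF finite_measure_axioms sets s] \<Phi>_def by simp
  qed
  moreover have "(\<integral>x. norm (sqrt s *\<^sub>R (x :: 'a)) powr \<alpha> \<partial>gaussian) = s powr (\<alpha> / 2) * (\<integral>x. norm (x :: 'a) powr \<alpha> \<partial>gaussian)"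
  proof -
    have "norm (sqrt s *\<^sub>R (x :: 'a)) powr \<alpha> = s powr (\<alpha> / 2) * norm x powr \<alpha>" for x
      using s by (simp add: powr_mult powr_half_sqrt[symmetric] powr_powr)
    then show ?thesis by simp
  qed
  ultimately show ?thesis by simp
qed

text \<open>
  The continuity theorem for moments on [0,1]: polynomials in v are uniformly dense in the continuous
  functions of v, and the convergent total masses control the approximation error. The measures live on
  an arbitrary space and v is only a bounded statistic of the points.
\<close>
lemma tendsto_integral_if_moments:
  fixes \<tau> :: "nat \<Rightarrow> 'b measure" and \<sigma> :: "'b measure" and v :: "'b \<Rightarrow> real" and h :: "real \<Rightarrow> real"
  assumes fin: "\<And>n. finite_measure (\<tau> n)" "finite_measure \<sigma>"
    and meas[measurable]: "\<And>n. v \<in> borel_measurable (\<tau> n)" "v \<in> borel_measurable \<sigma>"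
    and v: "\<And>x. v x \<in> {0..1}"
    and moments: "\<And>k. (\<lambda>n. \<integral>x. v x ^ k \<partial>\<tau> n) \<longlonglongrightarrow> (\<integral>x. v x ^ k \<partial>\<sigma>)"
    and h: "continuous_on UNIV h"
  shows "(\<lambda>n. \<integral>x. h (v x) \<partial>\<tau> n) \<longlonglongrightarrow> (\<integral>x. h (v x) \<partial>\<sigma>)"
proof -
  have h01: "continuous_on {0..1} h"
    using h continuous_on_subset by blast
  have [measurable]: "h \<in> borel_measurable borel"
    using h by (rule borel_measurable_continuous_onI)
  have "bounded (h ` {0..1})"
    using h01 compact_continuous_image compact_imp_bounded by blast
  then obtain H where H: "\<And>x. \<bar>h (v x)\<bar> \<le> H"
    using v by (force simp: bounded_iff)
  have int_pow: "integrable M (\<lambda>x. v x ^ k)" if "finite_measure M" "v \<in> borel_measurable M" for M k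
  proof -
    interpret finite_measure M by fact
    note that(2)[measurable]
    show ?thesis
      by (rule integrable_const_bound[where B=1]) (use v in \<open>auto simp: power_le_one\<close>)
  qed
  have int_h: "integrable M (\<lambda>x. h (v x))" if "finite_measure M" "v \<in> borel_measurable M" for M
  proof -
    interpret finite_measure M by fact
    note that(2)[measurable]
    show ?thesis
      by (rule integrable_const_bound[where B=H]) (use H in auto)
  qed
  have mass: "(\<lambda>n. measure (\<tau> n) (space (\<tau> n))) \<longlonglongrightarrow> measure \<sigma> (space \<sigma>)"
    using moments[of 0] by simp
  define B where "B = measure \<sigma> (space \<sigma>) + 1"
  have B: "0 < B" "measure \<sigma> (space \<sigma>) \<le> B"
    unfolding B_def by (auto intro: add_nonneg_pos)
  have evB: "\<forall>\<^sub>F n in sequentially. measure (\<tau> n) (space (\<tau> n)) < B"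
    using mass by (rule order_tendstoD(2)) (simp add: B_def)
  show ?thesis
  proof (rule tendstoI)
    fix \<epsilon> :: real assume "0 < \<epsilon>"
    \<comment> \<open>Three errors of size \<epsilon>/3: two from the polynomial approximation, whose effect is bounded by the
      total masses, and one from the convergence of finitely many moments.\<close>
    define \<delta> where "\<delta> = \<epsilon> / (3 * B)"
    have \<delta>: "0 < \<delta>" "\<delta> * B = \<epsilon> / 3" using \<open>0 < \<epsilon>\<close> B by (auto simp: \<delta>_def)
    obtain g where g: "real_polynomial_function g" "\<And>x. x \<in> {0..1} \<Longrightarrow> \<bar>h x - g x\<bar> < \<delta>"
      using Stone_Weierstrass_real_polynomial_function[OF _ h01 \<delta>(1)] by auto
    obtain c N where gc: "g = (\<lambda>x. \<Sum>i\<le>N. c i * x ^ i)"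
      using g(1) by (auto simp: real_polynomial_function_iff_sum)
    have int_g: "integrable M (\<lambda>x. g (v x))" "(\<integral>x. g (v x) \<partial>M) = (\<Sum>i\<le>N. c i * (\<integral>x. v x ^ i \<partial>M))"
      if "finite_measure M" "v \<in> borel_measurable M" for M
      unfolding gc using int_pow[OF that] by auto
    have close: "\<bar>(\<integral>x. h (v x) \<partial>M) - (\<integral>x. g (v x) \<partial>M)\<bar> \<le> \<epsilon> / 3"
      if M: "finite_measure M" "v \<in> borel_measurable M" "measure M (space M) \<le> B" for M
    proof -
      interpret finite_measure M by fact
      have "(\<integral>x. h (v x) \<partial>M) - (\<integral>x. g (v x) \<partial>M) = (\<integral>x. h (v x) - g (v x) \<partial>M)"
        using int_g(1)[OF M(1,2)] int_h[OF M(1,2)] by simp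
      also have "norm \<dots> \<le> (\<integral>x. norm (h (v x) - g (v x)) \<partial>M)"
        by (rule integral_norm_bound)
      also have "\<dots> \<le> (\<integral>x. \<delta> \<partial>M)"
      proof (rule integral_mono)
        show "integrable M (\<lambda>x. norm (h (v x) - g (v x)))"
          using int_g(1)[OF M(1,2)] int_h[OF M(1,2)] by simp
        show "norm (h (v x) - g (v x)) \<le> \<delta>" for x
          using g(2)[OF v[of x]] by simp
      qed simp
      also have "\<dots> \<le> \<delta> * B"
        using M(3) \<delta>(1) by (simp add: mult.commute mult_left_mono)
      finally show ?thesis using \<delta> by simp
    qed
    have "(\<lambda>n. \<integral>x. g (v x) \<partial>\<tau> n) \<longlonglongrightarrow> (\<integral>x. g (v x) \<partial>\<sigma>)"
      using int_g(2)[OF fin(1) meas(1)] int_g(2)[OF fin(2) meas(2)]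
      by (auto intro!: tendsto_intros moments)
    then have "\<forall>\<^sub>F n in sequentially. dist (\<integral>x. g (v x) \<partial>\<tau> n) (\<integral>x. g (v x) \<partial>\<sigma>) < \<epsilon> / 3"
      by (rule tendstoD) (use \<open>0 < \<epsilon>\<close> in simp)
    with evB show "\<forall>\<^sub>F n in sequentially. dist (\<integral>x. h (v x) \<partial>\<tau> n) (\<integral>x. h (v x) \<partial>\<sigma>) < \<epsilon>"
    proof eventually_elim
      case (elim n)
      have "\<bar>(\<integral>x. h (v x) \<partial>\<tau> n) - (\<integral>x. g (v x) \<partial>\<tau> n)\<bar> \<le> \<epsilon> / 3"
        by (rule close) (use elim fin in auto)
      moreover have "\<bar>(\<integral>x. h (v x) \<partial>\<sigma>) - (\<integral>x. g (v x) \<partial>\<sigma>)\<bar> \<le> \<epsilon> / 3"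
        by (rule close) (use B fin in auto)
      ultimately show ?case
        using elim(2) unfolding dist_real_def by linarith
    qed
  qed
qed

section \<open>Unimodal densities\<close>

text \<open>
  The density says nothing about a possible atom at the origin, hence the condition that the integrand
  vanishes there.
\<close>
lemma nn_integral_unimodal_density:
  fixes W :: "'a::euclidean_space \<Rightarrow> ennreal"
  assumes dens: "unimodal_density \<mu> f" and sets[measurable_cong]: "sets \<mu> = sets borel"
    and [measurable]: "W \<in> borel_measurable borel" and W0: "W 0 = 0"
  shows "(\<integral>\<^sup>+y. W y \<partial>\<mu>) = (\<integral>\<^sup>+y. ennreal (f y) * W y \<partial>lborel)"
proof -
  have [measurable]: "f \<in> borel_measurable borel"
    using dens by (simp add: unimodal_density_def)
  let ?i = "indicator (- {0}) :: 'a \<Rightarrow> ennreal"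
  have eq: "density \<mu> ?i = density lborel (\<lambda>y. ennreal (f y) * ?i y)"
  proof (rule measure_eqI)
    show "sets (density \<mu> ?i) = sets (density lborel (\<lambda>y. ennreal (f y) * ?i y))"
      by (simp add: sets)
    fix A assume "A \<in> sets (density \<mu> ?i)"
    then have [measurable]: "A \<in> sets borel" by (simp add: sets)
    have "emeasure (density \<mu> ?i) A = (\<integral>\<^sup>+y. indicator (A - {0}) y \<partial>\<mu>)"
    proof (subst emeasure_density)
      show "(\<integral>\<^sup>+y\<in>A. ?i y \<partial>\<mu>) = (\<integral>\<^sup>+y. indicator (A - {0}) y \<partial>\<mu>)"
        by (rule nn_integral_cong) (auto split: split_indicator)
    qed (auto simp: sets)
    also have "\<dots> = emeasure \<mu> (A - {0})"
      by (rule nn_integral_indicator) (simp add: sets)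
    also have "\<dots> = (\<integral>\<^sup>+y\<in>A - {0}. ennreal (f y) \<partial>lborel)"
      using dens unfolding unimodal_density_def by auto
    also have "\<dots> = emeasure (density lborel (\<lambda>y. ennreal (f y) * ?i y)) A"
      by (subst emeasure_density) (auto intro!: nn_integral_cong split: split_indicator)
    finally show "emeasure (density \<mu> ?i) A = emeasure (density lborel (\<lambda>y. ennreal (f y) * ?i y)) A" .
  qed
  have "(\<integral>\<^sup>+y. W y \<partial>\<mu>) = (\<integral>\<^sup>+y. ?i y * W y \<partial>\<mu>)"
    using W0 by (intro nn_integral_cong) (auto split: split_indicator)
  also have "\<dots> = (\<integral>\<^sup>+y. W y \<partial>density \<mu> ?i)"
    by (subst nn_integral_density) auto
  also have "\<dots> = (\<integral>\<^sup>+y. ennreal (f y) * ?i y * W y \<partial>lborel)"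
    unfolding eq by (subst nn_integral_density) auto
  also have "\<dots> = (\<integral>\<^sup>+y. ennreal (f y) * W y \<partial>lborel)"
    using W0 by (intro nn_integral_cong) (auto split: split_indicator)
  finally show ?thesis .
qed

lemma unimodal_density_scaleR:
  fixes \<mu> :: "'a::euclidean_space measure"
  assumes dens: "unimodal_density \<mu> f" and sets[measurable_cong]: "sets \<mu> = sets borel" and r: "0 < r"
  shows "unimodal_density (distr \<mu> borel (\<lambda>y. y /\<^sub>R r)) (\<lambda>y. r ^ DIM('a) * f (r *\<^sub>R y))"
  unfolding unimodal_density_def
proof (intro conjI allI impI ballI)
  have [measurable]: "f \<in> borel_measurable borel"
    using dens by (simp add: unimodal_density_def)
  show "(\<lambda>y. r ^ DIM('a) * f (r *\<^sub>R y)) \<in> borel_measurable borel" by measurable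
  show "0 \<le> r ^ DIM('a) * f (r *\<^sub>R x)" if "x \<noteq> 0" for x
    using dens r that by (auto simp: unimodal_density_def)
  show "r ^ DIM('a) * f (r *\<^sub>R x) = r ^ DIM('a) * f (r *\<^sub>R y)" if "x \<noteq> 0" "norm x = norm y" for x y
  proof -
    have "r *\<^sub>R x \<noteq> 0" "norm (r *\<^sub>R x) = norm (r *\<^sub>R y)" using that r by auto
    then have "f (r *\<^sub>R x) = f (r *\<^sub>R y)" using dens unfolding unimodal_density_def by blast
    then show ?thesis by simp
  qed
  show "r ^ DIM('a) * f (r *\<^sub>R y) \<le> r ^ DIM('a) * f (r *\<^sub>R x)" if "x \<noteq> 0" "norm x \<le> norm y" for x y
  proof -
    have "r *\<^sub>R x \<noteq> 0" "norm (r *\<^sub>R x) \<le> norm (r *\<^sub>R y)" using that r by auto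
    then have "f (r *\<^sub>R y) \<le> f (r *\<^sub>R x)" using dens unfolding unimodal_density_def by blast
    then show ?thesis using r by simp
  qed
  fix A :: "'a set" assume [measurable]: "A \<in> sets borel" and A0: "0 \<notin> A"
  let ?B = "(\<lambda>y. y /\<^sub>R r) -` A"
  have B[measurable]: "?B \<in> sets borel"
  proof -
    have "?B \<inter> space borel \<in> sets borel"
      by (rule measurable_sets[of _ borel borel]) auto
    then show ?thesis by simp
  qed
  have "emeasure (distr \<mu> borel (\<lambda>y. y /\<^sub>R r)) A = emeasure \<mu> ?B"
    using sets_eq_imp_space_eq[OF sets] by (subst emeasure_distr) auto
  also have "\<dots> = (\<integral>\<^sup>+x\<in>?B. ennreal (f x) \<partial>lborel)"
    using dens B A0 unfolding unimodal_density_def by auto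
  also have "\<dots> = (\<integral>\<^sup>+x. ennreal (f x) * indicator ?B x \<partial>density (distr lborel borel (\<lambda>x. 0 + r *\<^sub>R x)) (\<lambda>_. ennreal (\<bar>r\<bar> ^ DIM('a))))"
    using r by (subst lborel_affine[of r 0]) auto
  also have "\<dots> = (\<integral>\<^sup>+y. ennreal (r ^ DIM('a)) * (ennreal (f (r *\<^sub>R y)) * indicator ?B (r *\<^sub>R y)) \<partial>lborel)"
    using r by (subst nn_integral_density) (auto simp: nn_integral_distr)
  also have "\<dots> = (\<integral>\<^sup>+y\<in>A. ennreal (r ^ DIM('a) * f (r *\<^sub>R y)) \<partial>lborel)"
    using r by (intro nn_integral_cong) (auto simp: ennreal_mult' split: split_indicator)
  finally show "emeasure (distr \<mu> borel (\<lambda>y. y /\<^sub>R r)) A = (\<integral>\<^sup>+y\<in>A. ennreal (r ^ DIM('a) * f (r *\<^sub>R y)) \<partial>lborel)" .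
qed

text \<open>
  A continuous bump as a function of x = exp (- r^2 / 2), positive exactly for \<rho> < r < R. Testing with
  functions of this variable makes polynomial approximation on [0,1] available although the radius r is
  unbounded.
\<close>
definition annulus_bump :: "real \<Rightarrow> real \<Rightarrow> real \<Rightarrow> real" where
  "annulus_bump \<rho> R x = max 0 ((x - exp (- R\<^sup>2 / 2)) * (exp (- \<rho>\<^sup>2 / 2) - x))"

lemma annulus_bump_nonneg: "0 \<le> annulus_bump \<rho> R x"
  by (simp add: annulus_bump_def)

lemma continuous_annulus_bump: "continuous_on UNIV (annulus_bump \<rho> R)"
  unfolding annulus_bump_def by (intro continuous_intros)

lemma annulus_bump_pos_iff:
  assumes "0 < \<rho>" "\<rho> < R" "0 \<le> r"
  shows "0 < annulus_bump \<rho> R (exp (- r\<^sup>2 / 2)) \<longleftrightarrow> \<rho> < r \<and> r < R"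
proof -
  have sq: "x\<^sup>2 < y\<^sup>2 \<longleftrightarrow> x < y" if "0 \<le> x" "0 \<le> y" for x y :: real
    using that by (meson power2_less_imp_less power_strict_mono pos2)
  have "0 < annulus_bump \<rho> R (exp (- r\<^sup>2 / 2)) \<longleftrightarrow> 
    (r\<^sup>2 < R\<^sup>2 \<and> \<rho>\<^sup>2 < r\<^sup>2) \<or> (R\<^sup>2 < r\<^sup>2 \<and> r\<^sup>2 < \<rho>\<^sup>2)"
    unfolding annulus_bump_def by (auto simp: zero_less_mult_iff less_max_iff_disj)
  then show ?thesis
    using assms by (auto simp: sq)
qed

text \<open>
  T n is the integral of the weighted bump against the measure \<mu> n / a n, I its integral against Lebesgue measure,
  and L the limit of T n. Since the limit density is decreasing, its values at the two radii enclose L / I;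
  since f n is decreasing, its values on the two bounding spheres enclose T n * a n / I.
\<close>
lemma unimodal_limit_annulus:
  fixes \<mu> :: "nat \<Rightarrow> 'a::euclidean_space measure" and a :: "nat \<Rightarrow> real" and \<rho> R :: real
  assumes prob: "\<And>n. prob_space (\<mu> n)" and sets[measurable_cong]: "\<And>n. sets (\<mu> n) = sets borel"
    and pos: "\<And>n. 0 < a n" and \<alpha>: "0 < \<alpha>" "\<alpha> < 2"
    and lim: "\<And>x. (\<lambda>n. (\<integral>y. 1 - cos (x \<bullet> y) \<partial>\<mu> n) / a n) \<longlonglongrightarrow> norm x powr \<alpha>"
    and dens: "\<And>n. unimodal_density (\<mu> n) (f n)"
    and R: "0 < \<rho>" "\<rho> < R"
  obtains I T L where "0 < I" "T \<longlonglongrightarrow> L"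
    and "density_const DIM('a) \<alpha> * R powr (- real DIM('a) - \<alpha>) * I \<le> L"
    and "L \<le> density_const DIM('a) \<alpha> * \<rho> powr (- real DIM('a) - \<alpha>) * I"
    and "\<And>n e. norm e = \<rho> \<Longrightarrow> T n \<le> f n e / a n * I"
    and "\<And>n e. norm e = R \<Longrightarrow> f n e / a n * I \<le> T n"
proof -
  let ?c = "density_const DIM('a) \<alpha>" and ?d = "real DIM('a)"
  let ?G = "\<integral>x. norm (x :: 'a) powr \<alpha> \<partial>gaussian"
  have c: "0 < ?c" by (rule density_const_pos) fact+
  define v where "v y = exp (- (norm (y :: 'a))\<^sup>2 / 2)" for y
  have v_pow: "v y ^ k = exp (- real k * ((norm y)\<^sup>2 / 2))" for y k
    by (simp add: v_def exp_of_nat_mult[symmetric])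
  have v: "0 \<le> v y" "v y \<le> 1" for y
    by (auto simp: v_def)
  have [measurable]: "v \<in> borel_measurable borel"
    unfolding v_def by measurable
  define h where "h = annulus_bump \<rho> R"
  have h: "continuous_on UNIV h" "\<And>x. 0 \<le> h x"
    by (auto simp: h_def continuous_annulus_bump annulus_bump_nonneg)
  have [measurable]: "h \<in> borel_measurable borel"
    using h(1) by (rule borel_measurable_continuous_onI)
  have h_pos: "0 < h (v y) \<longleftrightarrow> \<rho> < norm y \<and> norm y < R" for y
    unfolding h_def v_def by (rule annulus_bump_pos_iff) (use R in auto)
  have "bounded (h ` {0..1})"
    by (intro compact_imp_bounded compact_continuous_image continuous_on_subset[OF h(1)]) auto
  then obtain H where "\<forall>y\<in>h ` {0..1}. norm y \<le> H"
    unfolding bounded_iff by blast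
  then have H: "\<bar>h x\<bar> \<le> H" if "x \<in> {0..1}" for x
    using that by auto
  \<comment> \<open>The bump multiplied by the weight 1 - v: this is the test function for the original measures.\<close>
  define W where "W y = (1 - v y) * h (v y)" for y
  have [measurable]: "W \<in> borel_measurable borel"
    unfolding W_def by measurable
  have W: "0 \<le> W y" "W y \<le> H" for y
  proof -
    have "(1 - v y) * h (v y) \<le> 1 * H"
      using v[of y] h(2) H[of "v y"] by (intro mult_mono) auto
    then show "W y \<le> H" by (simp add: W_def)
  qed (use v h in \<open>simp add: W_def\<close>)
  have W_pos: "0 < W y \<longleftrightarrow> \<rho> < norm y \<and> norm y < R" for y
  proof (cases "y = 0")
    case False
    then have "v y < 1" by (simp add: v_def)
    then show ?thesis using h_pos[of y] by (simp add: W_def zero_less_mult_iff)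
  qed (use R in \<open>simp add: W_def v_def\<close>)
  have W_zero: "W y = 0" if "\<not> (\<rho> < norm y \<and> norm y < R)" for y
    using W_pos[of y] W(1)[of y] that by (auto simp: less_le)
  have int_W: "integrable lborel W"
  proof (rule Bochner_Integration.integrable_bound)
    show "integrable lborel (\<lambda>y :: 'a. indicator (cball 0 R) y * H)"
      by (intro integrable_mult_left integrable_real_indicator) (use emeasure_lborel_cball_finite[of "0 :: 'a" R] in auto)
    show "AE y in lborel. norm (W y) \<le> norm (indicator (cball 0 R) y * H)"
      using W W_zero by (intro AE_I2) (auto split: split_indicator simp: not_le intro!: order_trans[OF _ abs_ge_self])
  qed simp
  define I where "I = (\<integral>y. W y \<partial>lborel)"
  have "I \<noteq> 0"
  proof
    assume "I = 0"
    then have "AE y in lborel. W y = 0"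
      using integral_nonneg_eq_0_iff_AE[OF int_W] W by (auto simp: I_def)
    then have "AE y in lborel. y \<notin> {y :: 'a. \<rho> < norm y \<and> norm y < R}"
      by eventually_elim (simp add: W_pos[symmetric])
    moreover have op: "open {y :: 'a. \<rho> < norm y \<and> norm y < R}"
      by (intro open_Collect_conj open_Collect_less continuous_intros)
    obtain b :: 'a where b: "b \<in> Basis" by (meson SOME_Basis)
    have "norm (((\<rho> + R) / 2) *\<^sub>R b) = (\<rho> + R) / 2" using b R by simp
    then have ne: "((\<rho> + R) / 2) *\<^sub>R b \<in> {y. \<rho> < norm y \<and> norm y < R}" using R by simp
    ultimately have "{y :: 'a. \<rho> < norm y \<and> norm y < R} \<in> null_sets lborel"
      by (subst AE_iff_null_sets) auto
    then have "negligible {y :: 'a. \<rho> < norm y \<and> norm y < R}"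
      by (simp add: negligible_iff_null_sets null_sets_completionI)
    with op ne show False
      by (metis open_not_negligible empty_iff)
  qed
  moreover have "0 \<le> I" unfolding I_def by (rule integral_nonneg_AE) (simp add: W)
  ultimately have I: "0 < I" by simp
  have nn_I: "(\<integral>\<^sup>+y. ennreal (W y) \<partial>lborel) = ennreal I"
    unfolding I_def by (rule nn_integral_eq_integral[OF int_W]) (simp add: W)

  \<comment> \<open>Weighting with 1 - v makes the measures \<mu> n / a n and the jump measure finite, and a moment of order k is the
    difference of the integrals of 1 - v^(k+1) and 1 - v^k, whose limits are known.\<close>
  have stable: "has_bochner_integral lborel (\<lambda>y. ?c * ((1 - v y ^ k) * norm y powr (- ?d - \<alpha>))) (real k powr (\<alpha> / 2) * ?G)" for k
    using has_bochner_integral_stable[OF \<alpha>, of "real k", where 'a='a] by (simp add: v_pow)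
  define w where "w y = ?c * ((1 - v y) * norm y powr (- ?d - \<alpha>))" for y :: 'a
  have [measurable]: "w \<in> borel_measurable borel"
    unfolding w_def by measurable
  have w: "0 \<le> w y" for y
    using c v[of y] by (simp add: w_def)
  have int_w: "integrable lborel w"
    using integrable.intros[OF stable[of 1]]
    unfolding w_def[abs_def] power_one_right .
  define \<sigma> where "\<sigma> = density lborel (\<lambda>y. ennreal (w y))"
  define \<tau> where "\<tau> n = density (\<mu> n) (\<lambda>y. ennreal ((1 - v y) / a n))" for n
  have int_\<tau>: "(\<integral>y. g y \<partial>\<tau> n) = (\<integral>y. (1 - v y) * g y \<partial>\<mu> n) / a n" if [measurable]: "g \<in> borel_measurable borel" for g n
    unfolding \<tau>_def using v pos[of n] by (subst integral_density) auto
  have int_\<sigma>: "(\<integral>y. g y \<partial>\<sigma>) = (\<integral>y. w y * g y \<partial>lborel)" if [measurable]: "g \<in> borel_measurable borel" for g :: "'a \<Rightarrow> real"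
    unfolding \<sigma>_def using w by (subst integral_density) auto
  have "(\<lambda>n. \<integral>y. h (v y) \<partial>\<tau> n) \<longlonglongrightarrow> (\<integral>y. h (v y) \<partial>\<sigma>)"
  proof (rule tendsto_integral_if_moments[OF _ _ _ _ _ _ h(1)])
    show "finite_measure (\<tau> n)" for n
    proof -
      interpret prob_space "\<mu> n" by (rule prob)
      have "emeasure (\<tau> n) (space (\<tau> n)) = (\<integral>\<^sup>+y. ennreal ((1 - v y) / a n) \<partial>\<mu> n)"
        by (simp add: \<tau>_def emeasure_density cong: nn_integral_cong)
      also have "\<dots> \<le> (\<integral>\<^sup>+y. ennreal (1 / a n) \<partial>\<mu> n)"
        using v pos[of n] by (intro nn_integral_mono ennreal_leI divide_right_mono) auto
      also have "\<dots> < \<infinity>" by (simp add: emeasure_space_1)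
      finally show ?thesis by (intro finite_measureI) auto
    qed
    show "finite_measure \<sigma>"
    proof (rule finite_measureI)
      have "emeasure \<sigma> (space \<sigma>) = (\<integral>\<^sup>+y. ennreal (w y) \<partial>lborel)"
        by (simp add: \<sigma>_def emeasure_density)
      then show "emeasure \<sigma> (space \<sigma>) \<noteq> \<infinity>"
        using nn_integral_eq_integral[OF int_w] w by simp
    qed
    show "v \<in> borel_measurable (\<tau> n)" for n by (simp add: \<tau>_def)
    show "v \<in> borel_measurable \<sigma>" by (simp add: \<sigma>_def)
    show "v y \<in> {0..1}" for y using v by simp
    fix k
    have "(\<lambda>n. (\<integral>y. 1 - v y ^ Suc k \<partial>\<mu> n) / a n - (\<integral>y. 1 - v y ^ k \<partial>\<mu> n) / a n) \<longlonglongrightarrow>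
        real (Suc k) powr (\<alpha> / 2) * ?G - real k powr (\<alpha> / 2) * ?G"
      unfolding v_pow by (intro tendsto_diff tendsto_integral_one_minus_gaussian[OF prob sets pos \<alpha>(1) lim]) auto
    moreover have "(\<integral>y. 1 - v y ^ Suc k \<partial>\<mu> n) / a n - (\<integral>y. 1 - v y ^ k \<partial>\<mu> n) / a n = (\<integral>y. v y ^ k \<partial>\<tau> n)" for n
    proof -
      interpret prob_space "\<mu> n" by (rule prob)
      have "integrable (\<mu> n) (\<lambda>y. 1 - v y ^ j)" for j
        by (rule integrable_const_bound[where B=1]) (use v in \<open>auto simp: power_le_one\<close>)
      then have "(\<integral>y. 1 - v y ^ Suc k \<partial>\<mu> n) - (\<integral>y. 1 - v y ^ k \<partial>\<mu> n) = (\<integral>y. (1 - v y ^ Suc k) - (1 - v y ^ k) \<partial>\<mu> n)"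
        by (intro Bochner_Integration.integral_diff[symmetric])
      also have "\<dots> = (\<integral>y. (1 - v y) * v y ^ k \<partial>\<mu> n)"
        by (simp add: algebra_simps)
      finally show ?thesis
        by (simp only: int_\<tau> diff_divide_distrib[symmetric]) (simp add: int_\<tau>)
    qed
    moreover have "real (Suc k) powr (\<alpha> / 2) * ?G - real k powr (\<alpha> / 2) * ?G = (\<integral>y. v y ^ k \<partial>\<sigma>)"
    proof -
      have "has_bochner_integral lborel (\<lambda>y. ?c * ((1 - v y ^ Suc k) * norm y powr (- ?d - \<alpha>)) - ?c * ((1 - v y ^ k) * norm y powr (- ?d - \<alpha>)))
          (real (Suc k) powr (\<alpha> / 2) * ?G - real k powr (\<alpha> / 2) * ?G)"
        by (intro has_bochner_integral_diff stable)
      also have "(\<lambda>y. ?c * ((1 - v y ^ Suc k) * norm y powr (- ?d - \<alpha>)) - ?c * ((1 - v y ^ k) * norm y powr (- ?d - \<alpha>))) = (\<lambda>y. w y * v y ^ k)"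
        by (simp add: w_def algebra_simps)
      finally show ?thesis
        by (simp add: int_\<sigma> has_bochner_integral_integral_eq)
    qed
    ultimately show "(\<lambda>n. \<integral>y. v y ^ k \<partial>\<tau> n) \<longlonglongrightarrow> (\<integral>y. v y ^ k \<partial>\<sigma>)"
      by simp
  qed
  then have T: "(\<lambda>n. (\<integral>y. W y \<partial>\<mu> n) / a n) \<longlonglongrightarrow> (\<integral>y. h (v y) \<partial>\<sigma>)"
    by (simp add: int_\<tau> W_def)
  have L: "(\<integral>y. h (v y) \<partial>\<sigma>) = (\<integral>y. ?c * norm y powr (- ?d - \<alpha>) * W y \<partial>lborel)"
    by (simp add: int_\<sigma> w_def W_def mult_ac)
  have bounds: "?c * R powr (- ?d - \<alpha>) * W y \<le> ?c * norm y powr (- ?d - \<alpha>) * W y"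
    "?c * norm y powr (- ?d - \<alpha>) * W y \<le> ?c * \<rho> powr (- ?d - \<alpha>) * W y" for y :: 'a
  proof -
    have "R powr (- ?d - \<alpha>) \<le> norm y powr (- ?d - \<alpha>) \<and> norm y powr (- ?d - \<alpha>) \<le> \<rho> powr (- ?d - \<alpha>)"
      if "\<rho> < norm y" "norm y < R"
      using that R \<alpha> by (auto intro!: powr_mono2')
    then show "?c * R powr (- ?d - \<alpha>) * W y \<le> ?c * norm y powr (- ?d - \<alpha>) * W y"
      "?c * norm y powr (- ?d - \<alpha>) * W y \<le> ?c * \<rho> powr (- ?d - \<alpha>) * W y"
      using W(1)[of y] W_zero[of y] c by (cases "\<rho> < norm y \<and> norm y < R"; auto intro!: mult_right_mono)+
  qed
  have int_L: "integrable lborel (\<lambda>y. ?c * norm y powr (- ?d - \<alpha>) * W y)"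
  proof (rule Bochner_Integration.integrable_bound)
    show "integrable lborel (\<lambda>y. ?c * \<rho> powr (- ?d - \<alpha>) * W y)"
      using int_W by simp
    show "AE y in lborel. norm (?c * norm y powr (- ?d - \<alpha>) * W y) \<le> norm (?c * \<rho> powr (- ?d - \<alpha>) * W y)"
      using bounds(2) W(1) c by (intro AE_I2) simp
  qed simp
  have f: "0 \<le> f n e" "\<And>y. norm e \<le> norm y \<Longrightarrow> f n y \<le> f n e" "\<And>y. y \<noteq> 0 \<Longrightarrow> norm y \<le> norm e \<Longrightarrow> f n e \<le> f n y"
    if "e \<noteq> 0" for n e
    using dens[of n] that unfolding unimodal_density_def by blast+
  have nn_T: "ennreal (\<integral>y. W y \<partial>\<mu> n) = (\<integral>\<^sup>+y. ennreal (f n y) * ennreal (W y) \<partial>lborel)" for n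
  proof -
    interpret prob_space "\<mu> n" by (rule prob)
    have "integrable (\<mu> n) W"
      by (rule integrable_const_bound[where B=H]) (use W in auto)
    then have "ennreal (\<integral>y. W y \<partial>\<mu> n) = (\<integral>\<^sup>+y. ennreal (W y) \<partial>\<mu> n)"
      by (intro nn_integral_eq_integral[symmetric]) (simp_all add: W)
    also have "\<dots> = (\<integral>\<^sup>+y. ennreal (f n y) * ennreal (W y) \<partial>lborel)"
      by (rule nn_integral_unimodal_density[OF dens sets]) (use W_zero[of 0] R in auto)
    finally show ?thesis .
  qed
  have const: "(\<integral>\<^sup>+y. ennreal (f n e) * ennreal (W y) \<partial>lborel) = ennreal (f n e * I)" if "e \<noteq> 0" for n e
    using f(1)[OF that, of n] by (subst nn_integral_cmult) (auto simp: nn_I ennreal_mult')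
  show thesis
  proof (rule that[OF I T])
    show "?c * R powr (- ?d - \<alpha>) * I \<le> (\<integral>y. h (v y) \<partial>\<sigma>)"
    proof -
      have "?c * R powr (- ?d - \<alpha>) * I = (\<integral>y. ?c * R powr (- ?d - \<alpha>) * W y \<partial>lborel)"
        by (simp add: I_def)
      also have "\<dots> \<le> (\<integral>y. ?c * norm y powr (- ?d - \<alpha>) * W y \<partial>lborel)"
        by (rule integral_mono) (use int_W int_L bounds in auto)
      finally show ?thesis by (simp only: L)
    qed
    show "(\<integral>y. h (v y) \<partial>\<sigma>) \<le> ?c * \<rho> powr (- ?d - \<alpha>) * I"
    proof -
      have "(\<integral>y. ?c * norm y powr (- ?d - \<alpha>) * W y \<partial>lborel) \<le> (\<integral>y. ?c * \<rho> powr (- ?d - \<alpha>) * W y \<partial>lborel)"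
        by (rule integral_mono) (use int_W int_L bounds in auto)
      also have "\<dots> = ?c * \<rho> powr (- ?d - \<alpha>) * I"
        by (simp add: I_def)
      finally show ?thesis by (simp only: L)
    qed
    show "(\<integral>y. W y \<partial>\<mu> n) / a n \<le> f n e / a n * I" if e: "norm e = \<rho>" for n e
    proof -
      have e0: "e \<noteq> 0" using e R by auto
      have "ennreal (\<integral>y. W y \<partial>\<mu> n) \<le> (\<integral>\<^sup>+y. ennreal (f n e) * ennreal (W y) \<partial>lborel)"
        unfolding nn_T
      proof (rule nn_integral_mono)
        show "ennreal (f n y) * ennreal (W y) \<le> ennreal (f n e) * ennreal (W y)" for y
          using f(2)[OF e0, of y n] e W_zero[of y]
          by (cases "\<rho> < norm y \<and> norm y < R") (auto intro!: mult_right_mono ennreal_leI)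
      qed
      then have "(\<integral>y. W y \<partial>\<mu> n) \<le> f n e * I"
        unfolding const[OF e0] using f(1)[OF e0] I by (subst (asm) ennreal_le_iff) auto
      then show ?thesis
        using pos[of n] by (simp add: divide_right_mono)
    qed
    show "f n e / a n * I \<le> (\<integral>y. W y \<partial>\<mu> n) / a n" if e: "norm e = R" for n e
    proof -
      have e0: "e \<noteq> 0" using e R by auto
      have "(\<integral>\<^sup>+y. ennreal (f n e) * ennreal (W y) \<partial>lborel) \<le> ennreal (\<integral>y. W y \<partial>\<mu> n)"
        unfolding nn_T
      proof (rule nn_integral_mono)
        show "ennreal (f n e) * ennreal (W y) \<le> ennreal (f n y) * ennreal (W y)" for y
          using f(3)[OF e0, of y n] e W_zero[of y] R(1)
          by (cases "\<rho> < norm y \<and> norm y < R"; cases "y = 0") (auto intro!: mult_right_mono ennreal_leI)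
      qed
      then have "f n e * I \<le> (\<integral>y. W y \<partial>\<mu> n)"
        unfolding const[OF e0] using W by (subst (asm) ennreal_le_iff) (auto intro!: integral_nonneg_AE)
      then show ?thesis
        using pos[of n] by (simp add: divide_right_mono)
    qed
  qed
qed

text \<open>
  The monotone density argument. An annulus just outside the unit sphere bounds the density from below, one
  just inside bounds it from above, and both bounds tend to the same constant as the annuli shrink. Weak
  convergence alone would not give pointwise convergence of densities; monotonicity does.
\<close>
lemma unimodal_density_tendsto:
  fixes \<mu> :: "nat \<Rightarrow> 'a::euclidean_space measure" and a :: "nat \<Rightarrow> real"
  assumes prob: "\<And>n. prob_space (\<mu> n)" and sets: "\<And>n. sets (\<mu> n) = sets borel"
    and pos: "\<And>n. 0 < a n" and \<alpha>: "0 < \<alpha>" "\<alpha> < 2"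
    and lim: "\<And>x. (\<lambda>n. (\<integral>y. 1 - cos (x \<bullet> y) \<partial>\<mu> n) / a n) \<longlonglongrightarrow> norm x powr \<alpha>"
    and dens: "\<And>n. unimodal_density (\<mu> n) (f n)"
    and e: "\<And>n. norm (e n) = 1"
  shows "(\<lambda>n. f n (e n) / a n) \<longlonglongrightarrow> density_const DIM('a) \<alpha>"
proof (rule order_tendstoI)
  let ?c = "density_const DIM('a) \<alpha>" and ?d = "real DIM('a)"
  let ?g = "\<lambda>r. ?c * r powr (- ?d - \<alpha>)"
  have g: "(?g \<longlongrightarrow> ?c) (at 1 within S)" for S
    by (auto intro!: tendsto_eq_intros)
  fix l assume "l < ?c"
  then have "\<forall>\<^sub>F r in at_right 1. l < ?g r \<and> 1 < r"
    by (intro eventually_conj order_tendstoD(1)[OF g] eventually_at_right_less)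
  then obtain R where R: "l < ?g R" "1 < R"
    using eventually_happens'[OF trivial_limit_at_right_real] by blast
  obtain I T L where T: "0 < I" "T \<longlonglongrightarrow> L" "?g R * I \<le> L" "L \<le> ?g 1 * I"
    "\<And>n e. norm e = 1 \<Longrightarrow> T n \<le> f n e / a n * I" "\<And>n e. norm e = R \<Longrightarrow> f n e / a n * I \<le> T n"
    by (rule unimodal_limit_annulus[OF prob sets pos \<alpha> lim dens zero_less_one R(2)]) (rule that)
  have "l * I < L"
    using mult_strict_right_mono[OF R(1) T(1)] T(3) by linarith
  then have "\<forall>\<^sub>F n in sequentially. l * I < T n"
    by (rule order_tendstoD(1)[OF T(2)])
  then show "\<forall>\<^sub>F n in sequentially. l < f n (e n) / a n"
  proof eventually_elim
    case (elim n)
    with T(5)[OF e[of n], of n] have "l * I < f n (e n) / a n * I" by simp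
    then show ?case using T(1) by (simp add: mult_less_cancel_right_pos del: times_divide_eq_left)
  qed
next
  let ?c = "density_const DIM('a) \<alpha>" and ?d = "real DIM('a)"
  let ?g = "\<lambda>r. ?c * r powr (- ?d - \<alpha>)"
  have g: "(?g \<longlongrightarrow> ?c) (at 1 within S)" for S
    by (auto intro!: tendsto_eq_intros)
  fix l assume "?c < l"
  then have "\<forall>\<^sub>F r in at_left 1. ?g r < l \<and> r \<in> {0<..<1}"
    by (intro eventually_conj order_tendstoD(2)[OF g] eventually_at_left_real) auto
  then obtain \<rho> where \<rho>: "?g \<rho> < l" "0 < \<rho>" "\<rho> < 1"
    using eventually_happens'[OF trivial_limit_at_left_real] by fastforce
  obtain I T L where T: "0 < I" "T \<longlonglongrightarrow> L" "?g 1 * I \<le> L" "L \<le> ?g \<rho> * I"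
    "\<And>n e. norm e = \<rho> \<Longrightarrow> T n \<le> f n e / a n * I" "\<And>n e. norm e = 1 \<Longrightarrow> f n e / a n * I \<le> T n"
    by (rule unimodal_limit_annulus[OF prob sets pos \<alpha> lim dens \<rho>(2,3)]) (rule that)
  have "L < l * I"
    using mult_strict_right_mono[OF \<rho>(1) T(1)] T(4) by linarith
  then have "\<forall>\<^sub>F n in sequentially. T n < l * I"
    by (rule order_tendstoD(2)[OF T(2)])
  then show "\<forall>\<^sub>F n in sequentially. f n (e n) / a n < l"
  proof eventually_elim
    case (elim n)
    with T(6)[OF e[of n], of n] have "f n (e n) / a n * I < l * I" by simp
    then show ?case using T(1) by (simp add: mult_less_cancel_right_pos del: times_divide_eq_left)
  qed
qed

section \<open>The asymptotics of the transition density\<close>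

text \<open>
  Replaces the characteristic exponent q by 1 - exp (- q), squeezing the latter between q / (1 + q) and q.
\<close>
lemma tendsto_one_minus_exp_quotient:
  fixes q a :: "nat \<Rightarrow> real"
  assumes q: "\<And>n. 0 \<le> q n" and a: "\<And>n. 0 < a n" and a0: "a \<longlonglongrightarrow> 0"
    and lim: "(\<lambda>n. q n / a n) \<longlonglongrightarrow> l"
  shows "(\<lambda>n. (1 - exp (- q n)) / a n) \<longlonglongrightarrow> l"
proof (rule tendsto_sandwich)
  have "(\<lambda>n. q n / a n * a n) \<longlonglongrightarrow> l * 0"
    by (intro tendsto_mult lim a0)
  then have q0: "q \<longlonglongrightarrow> 0"
    using a by (simp add: less_imp_neq[THEN not_sym])
  have "(\<lambda>n. q n / a n / (1 + q n)) \<longlonglongrightarrow> l / (1 + 0)"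
    by (intro tendsto_intros lim q0) simp
  then show "(\<lambda>n. q n / a n / (1 + q n)) \<longlonglongrightarrow> l" by simp
  show "\<forall>\<^sub>F n in sequentially. (1 - exp (- q n)) / a n \<le> q n / a n"
  proof (rule always_eventually, rule allI)
    fix n
    show "(1 - exp (- q n)) / a n \<le> q n / a n"
      using exp_ge_add_one_self[of "- q n"] a[of n] by (intro divide_right_mono) auto
  qed
  show "\<forall>\<^sub>F n in sequentially. q n / a n / (1 + q n) \<le> (1 - exp (- q n)) / a n"
  proof (rule always_eventually, rule allI)
    fix n
    have "exp (- q n) \<le> inverse (1 + q n)"
      unfolding exp_minus using q[of n] by (intro le_imp_inverse_le) auto
    then have "q n / (1 + q n) \<le> 1 - exp (- q n)"
      using q[of n] by (simp add: field_simps)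
    then have "q n / (1 + q n) / a n \<le> (1 - exp (- q n)) / a n"
      using a[of n] by (intro divide_right_mono) auto
    then show "q n / a n / (1 + q n) \<le> (1 - exp (- q n)) / a n"
      by (simp add: mult.commute)
  qed
qed (rule lim)

lemma regularly_varying_at_zeroD:
  fixes r :: "nat \<Rightarrow> real"
  assumes rv: "regularly_varying_at_zero \<alpha> \<psi>" and r: "filterlim r at_top sequentially" and s: "0 < s"
  shows "(\<lambda>n. \<psi> (s / r n) / \<psi> (1 / r n)) \<longlonglongrightarrow> s powr \<alpha>"
proof -
  have "((\<lambda>x. inverse (\<psi> (inverse (inverse s * x))) / inverse (\<psi> (inverse x))) \<longlongrightarrow> inverse s powr \<alpha>) at_top"
    using rv s unfolding regularly_varying_at_zero_def regularly_varying_at_top_def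
    by (blast intro: positive_imp_inverse_positive)
  then have "(\<lambda>n. inverse (\<psi> (inverse (inverse s * r n))) / inverse (\<psi> (inverse (r n)))) \<longlonglongrightarrow> inverse s powr \<alpha>"
    using r by (rule filterlim_compose)
  then have "(\<lambda>n. inverse (inverse (\<psi> (inverse (inverse s * r n))) / inverse (\<psi> (inverse (r n))))) \<longlonglongrightarrow> inverse (inverse s powr \<alpha>)"
    by (rule tendsto_inverse) (use s in simp)
  moreover have "inverse (inverse s powr \<alpha>) = s powr \<alpha>"
    using s by (simp add: inverse_eq_divide powr_divide)
  ultimately show ?thesis
    by (simp add: divide_inverse mult.commute)
qed

theorem theorem4:
  fixes M :: "'w measure"
    and X :: "real \<Rightarrow> 'w \<Rightarrow> 'a::euclidean_space"
    and p :: "real \<Rightarrow> 'a \<Rightarrow> real"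
    and \<psi> :: "real \<Rightarrow> real"
    and \<alpha> :: real
  assumes "isotropic_unimodal_levy_process M X"
    and "levy_khintchine_exponent M X (\<lambda>\<xi>. \<psi> (norm \<xi>))"
    and "transition_density M X p"
    and "0 < \<alpha>" and "\<alpha> < 2"
    and "regularly_varying_at_zero \<alpha> \<psi>"
  shows "\<forall>\<epsilon>>0. \<exists>\<delta>>0. \<forall>t>0. \<forall>x.
    inverse \<delta> \<le> norm x \<and> t * \<psi> (inverse (norm x)) \<le> \<delta> \<longrightarrow>
    \<bar>p t x / (norm x powr (- real DIM('a)) * t * \<psi> (inverse (norm x)))
       - density_const DIM('a) \<alpha>\<bar> < \<epsilon>"
proof (intro allI impI, rule ccontr)
  let ?c = "density_const DIM('a) \<alpha>" and ?d = "real DIM('a)"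
  let ?Q = "\<lambda>t x. p t x / (norm x powr (- ?d) * t * \<psi> (inverse (norm x)))"
  fix \<epsilon> :: real
  assume \<epsilon>: "0 < \<epsilon>" and neg: "\<not> (\<exists>\<delta>>0. \<forall>t>0. \<forall>x. inverse \<delta> \<le> norm x \<and> t * \<psi> (inverse (norm x)) \<le> \<delta> \<longrightarrow>
      \<bar>?Q t x - ?c\<bar> < \<epsilon>)"
  have bad: "\<exists>t>0. \<exists>x. inverse \<delta> \<le> norm x \<and> t * \<psi> (inverse (norm x)) \<le> \<delta> \<and> \<epsilon> \<le> \<bar>?Q t x - ?c\<bar>"
    if "0 < \<delta>" for \<delta>
    using neg that by (meson not_less)
  obtain x0 where x0: "0 < x0" "\<And>x. x0 \<le> x \<Longrightarrow> 0 < \<psi> (inverse x)"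
    using assms(6) unfolding regularly_varying_at_zero_def regularly_varying_at_top_def by auto
  define \<delta> where "\<delta> n = min (inverse x0) (inverse (real (Suc n)))" for n
  have \<delta>: "0 < \<delta> n" for n using x0 by (simp add: \<delta>_def)
  obtain t x where t: "\<And>n. 0 < t n" and x: "\<And>n. inverse (\<delta> n) \<le> norm (x n)"
    and small: "\<And>n. t n * \<psi> (inverse (norm (x n))) \<le> \<delta> n"
    and away: "\<And>n. \<epsilon> \<le> \<bar>?Q (t n) (x n) - ?c\<bar>"
    using bad[OF \<delta>] by metis
  \<comment> \<open>From here on the violating sequence is rescaled so that all points lie on the unit sphere.\<close>
  define r where "r n = norm (x n)" for n
  define a where "a n = t n * \<psi> (inverse (r n))" for n
  have r_ge: "x0 \<le> r n" "real (Suc n) \<le> r n" for n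
  proof -
    have "inverse (inverse x0) \<le> inverse (\<delta> n)" "inverse (inverse (real (Suc n))) \<le> inverse (\<delta> n)"
      using \<delta>[of n] by (intro le_imp_inverse_le; simp add: \<delta>_def)+
    then show "x0 \<le> r n" "real (Suc n) \<le> r n"
      using x[of n] by (auto simp: r_def)
  qed
  have r: "0 < r n" for n using r_ge(1)[of n] x0(1) by linarith
  have \<psi>_pos: "0 < \<psi> (inverse (r n))" for n using x0(2) r_ge(1) by blast
  have a: "0 < a n" for n using t \<psi>_pos by (simp add: a_def)
  have "filterlim (\<lambda>n. real (Suc n)) at_top sequentially"
    by (rule filterlim_compose[OF filterlim_real_sequentially filterlim_Suc])
  then have r_lim: "filterlim r at_top sequentially"
    by (rule filterlim_at_top_mono) (use r_ge(2) in auto)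
  have a_lim: "a \<longlonglongrightarrow> 0"
  proof (rule tendsto_sandwich[OF _ _ tendsto_const LIMSEQ_inverse_real_of_nat])
    show "\<forall>\<^sub>F n in sequentially. 0 \<le> a n" using a by (simp add: less_imp_le)
    show "\<forall>\<^sub>F n in sequentially. a n \<le> inverse (real (Suc n))"
      using small by (auto simp: a_def r_def \<delta>_def intro!: always_eventually)
  qed
  interpret levy_process M X
    using assms(1) by (simp add: isotropic_unimodal_levy_process_def isotropic_levy_process_def)
  have X[measurable]: "X (t n) \<in> borel_measurable M" for n
    using t[of n] by (intro random_variable) simp
  define \<nu> where "\<nu> n = distr M borel (X (t n))" for n
  define \<mu> where "\<mu> n = distr (\<nu> n) borel (\<lambda>y. y /\<^sub>R r n)" for n
  have \<nu>: "prob_space (\<nu> n)" "sets (\<nu> n) = sets borel" for n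
    by (auto simp: \<nu>_def intro: prob_space_distr)
  have \<mu>: "prob_space (\<mu> n)" "sets (\<mu> n) = sets borel" for n
    using \<nu> by (auto simp: \<mu>_def intro!: prob_space.prob_space_distr cong: measurable_cong_sets)
  have cos_\<nu>: "(\<integral>y. cos (\<xi> \<bullet> y) \<partial>\<nu> n) = exp (- (t n * \<psi> (norm \<xi>)))" for n \<xi>
  proof -
    interpret N: prob_space "\<nu> n" by (rule \<nu>)
    note \<nu>(2)[measurable_cong]
    have "(CLINT y|\<nu> n. iexp (\<xi> \<bullet> y)) = complex_of_real (exp (- t n * \<psi> (norm \<xi>)))"
      using assms(2) t[of n] unfolding levy_khintchine_exponent_def \<nu>_def by simp
    then have "Re (CLINT y|\<nu> n. iexp (\<xi> \<bullet> y)) = exp (- (t n * \<psi> (norm \<xi>)))"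
      by simp
    moreover have "Re (CLINT y|\<nu> n. iexp (\<xi> \<bullet> y)) = (\<integral>y. cos (\<xi> \<bullet> y) \<partial>\<nu> n)"
      by (subst integral_Re[symmetric]) (auto intro!: N.integrable_const_bound[where B=1] simp: Re_exp)
    ultimately show ?thesis by simp
  qed
  have cos_\<mu>: "(\<integral>y. 1 - cos (\<xi> \<bullet> y) \<partial>\<mu> n) = 1 - exp (- (t n * \<psi> (norm \<xi> / r n)))" for n \<xi>
  proof -
    interpret N: prob_space "\<nu> n" by (rule \<nu>)
    note \<nu>(2)[measurable_cong]
    have "(\<integral>y. 1 - cos (\<xi> \<bullet> y) \<partial>\<mu> n) = (\<integral>y. 1 - cos ((\<xi> /\<^sub>R r n) \<bullet> y) \<partial>\<nu> n)"
      unfolding \<mu>_def by (subst integral_distr) auto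
    also have "\<dots> = 1 - (\<integral>y. cos ((\<xi> /\<^sub>R r n) \<bullet> y) \<partial>\<nu> n)"
      by (subst Bochner_Integration.integral_diff) (auto intro!: N.integrable_const_bound[where B=1] simp: N.prob_space)
    finally show ?thesis
      using r[of n] unfolding cos_\<nu> by (simp add: divide_inverse mult.commute)
  qed
  have \<psi>_nonneg: "0 \<le> t n * \<psi> (norm (\<xi> :: 'a) / r n)" for n \<xi>
  proof -
    interpret N: prob_space "\<mu> n" by (rule \<mu>)
    have "0 \<le> (\<integral>y. 1 - cos (\<xi> \<bullet> y) \<partial>\<mu> n)"
      by (rule integral_nonneg_AE) simp
    then show ?thesis unfolding cos_\<mu> by simp
  qed
  have "(\<lambda>n. (\<integral>y. 1 - cos (\<xi> \<bullet> y) \<partial>\<mu> n) / a n) \<longlonglongrightarrow> norm \<xi> powr \<alpha>" for \<xi>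
  proof (cases "\<xi> = 0")
    case False
    have "(\<lambda>n. \<psi> (norm \<xi> / r n) / \<psi> (1 / r n)) \<longlonglongrightarrow> norm \<xi> powr \<alpha>"
      by (rule regularly_varying_at_zeroD[OF assms(6) r_lim]) (use False in simp)
    moreover have "\<psi> (norm \<xi> / r n) / \<psi> (1 / r n) = t n * \<psi> (norm \<xi> / r n) / a n" for n
      using t[of n] by (simp add: a_def inverse_eq_divide)
    ultimately show ?thesis
      unfolding cos_\<mu> by (intro tendsto_one_minus_exp_quotient \<psi>_nonneg a a_lim) simp
  qed simp
  moreover have "unimodal_density (\<mu> n) (\<lambda>y. r n ^ DIM('a) * p (t n) (r n *\<^sub>R y))" for n
    unfolding \<mu>_def
    by (rule unimodal_density_scaleR[OF _ \<nu>(2) r])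
      (use assms(3) t[of n] in \<open>simp add: transition_density_def \<nu>_def\<close>)
  moreover have "norm (x n /\<^sub>R r n) = 1" for n
    using r[of n] by (simp add: r_def)
  ultimately have "(\<lambda>n. r n ^ DIM('a) * p (t n) (r n *\<^sub>R (x n /\<^sub>R r n)) / a n) \<longlonglongrightarrow> ?c"
    by (intro unimodal_density_tendsto[OF \<mu> a assms(4,5)])
  moreover have "r n ^ DIM('a) * p (t n) (r n *\<^sub>R (x n /\<^sub>R r n)) / a n = ?Q (t n) (x n)" for n
  proof -
    have "norm (x n) powr (- ?d) = inverse (norm (x n) ^ DIM('a))"
      using r[of n] by (simp add: r_def powr_minus powr_realpow)
    moreover have "r n *\<^sub>R (x n /\<^sub>R r n) = x n"
      using r[of n] by simp
    ultimately show ?thesis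
      by (simp only: a_def r_def) (simp add: divide_inverse mult_ac)
  qed
  ultimately have "(\<lambda>n. ?Q (t n) (x n)) \<longlonglongrightarrow> ?c" by simp
  then have "\<forall>\<^sub>F n in sequentially. dist (?Q (t n) (x n)) ?c < \<epsilon>"
    using \<epsilon> by (rule tendstoD)
  then obtain n where "dist (?Q (t n) (x n)) ?c < \<epsilon>"
    by (auto simp: eventually_sequentially)
  with away[of n] show False by (simp add: dist_real_def)
qed

end
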